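(* In the setting described in the context, if there exists an $A_n$–$B_m$–coherent trail for some $n,m\in\mathbb N$, then there also exists an $A_0$–$B_0$–coherent trail.
   Context: All graphs are finite and simple; $[n]=\{1,\dots,n\}$, $[0,n]=\{0,\dots,n\}$, $\mathbb N=\{0,1,2,\dots\}$. A trail is a walk $q_0\dots q_w$ with distinct edges; a circuit is a closed trail. Setting: $G=(V,E)$ is a 2-edge-connected graph, $k\ge1$, $e_1,\dots,e_{k+1}$ are edges of $G$, $e_{k+1}=ab$, and $H$ is a shortest circuit in $G$ containing $e_1,\dots,e_k$, labelled in traversal order so that $H=H_1e_1H_2e_2\dots e_{k-1}H_ke_k$ with segments $H_1,\dots,H_k$; each $H_j$ is a path and $<_j$ is the order in which $H$ traverses $V(H_j)$. Subtrail: a trail $P=p_0\dots p_r$ is a subtrail of $Q=q_0\dots q_w$ with witnessing interval $I_P=\{t,\dots,t+r\}\subseteq[0,w]$ if $p_h=q_{t+h}$ for all $h\in[0,r]$, or $p_h=q_{t+r-h}$ for all $h\in[0,r]$ (the empty trail is a subtrail with empty witnessing interval). For $U\subseteq V$, $j\in[k]$: $\mathrm{Ins}_j(U)=U\cap V(H_j)$; $\mathrm{Cl}_j(U)$ is the subpath of $H_j$ from $\min_{<_j}\mathrm{Ins}_j(U)$ to $\max_{<_j}\mathrm{Ins}_j(U)$ (empty if $\mathrm{Ins}_j(U)=\emptyset$); $\mathrm{Cl}(U)=\bigcup_{j}V(\mathrm{Cl}_j(U))$. An $x$–$y$ trail $P$ is admissible if it lies in $G-E(H)-e_{k+1}$ and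 $V(P)\cap V(H)\subseteq\{x,y\}$ (trivial trails allowed). $\mathrm{Reach}(X)=\{y'\in V(H):\exists x'\in X$ with an admissible $x'$–$y'$ trail$\}$. $A_0=\emptyset$, $A_1=\mathrm{Reach}(\{a\})$, $A_{i+1}=\mathrm{Reach}(\mathrm{Cl}(A_i))$ for $i\ge1$; $B_i$ analogously with $b$. For $n,m\in\mathbb N$, a trail $Q=q_0\dots q_w$ is $A_n$–$B_m$–coherent if: (C1) $e_1,\dots,e_k\in E(Q)$, $q_0\in A_{n+1}$ and $q_w\in B_{m+1}$; (C2) for every $s\in[w]$ with $q_{s-1}q_s\in E\setminus E(H)$ there are $r,t\in[0,w]$ with $r<s\le t$, $q_r,q_t\in V(H)$, such that $q_r\dots q_t$ (the part of $Q$ between indices $r$ and $t$) is an admissible $q_r$–$q_t$ trail, and each of $A_{n+1}$ and $B_{m+1}$ contains at most one of $q_r,q_t$; (C3) for every $j\in[k]$, $\mathrm{Cl}_j(A_n)$ and $\mathrm{Cl}_j(B_m)$ are subtrails of $Q$ with witnessing intervals $I_{A_n,j}$ and $I_{B_m,j}$ such that $I_{X,j}\cap I_{Y,j'}=\emptyset$ for all $X,Y\in\{A_n,B_m\}$ and all distinct $j\neq j'$ in $[k]$. *)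

theory Defs
  imports Main
begin

text \<open>
  A finite simple graph is given by a vertex set \<open>V\<close> and a set \<open>E\<close> of two-element subsets of \<open>V\<close>.
  A walk \<open>q\<^sub>0 \<dots> q\<^sub>w\<close> is the nonempty list of its \<open>w + 1\<close> vertices; since graphs are simple, the list
  determines the edges. The empty list is not a walk; it represents the empty trail where needed.
\<close>

definition simple_graph :: "'a set \<Rightarrow> 'a set set \<Rightarrow> bool" where
  "simple_graph V E \<longleftrightarrow> finite V \<and> E \<subseteq> {{u, v} | u v. u \<in> V \<and> v \<in> V \<and> u \<noteq> v}"

definition walk_edges :: "'a list \<Rightarrow> 'a set list" where
  "walk_edges q = map (\<lambda>(u, v). {u, v}) (zip q (tl q))"

abbreviation edges_of :: "'a list \<Rightarrow> 'a set set" where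
  "edges_of q \<equiv> set (walk_edges q)"

definition walk :: "'a set \<Rightarrow> 'a set set \<Rightarrow> 'a list \<Rightarrow> bool" where
  "walk V E q \<longleftrightarrow> q \<noteq> [] \<and> set q \<subseteq> V \<and> edges_of q \<subseteq> E"

definition trail :: "'a set \<Rightarrow> 'a set set \<Rightarrow> 'a list \<Rightarrow> bool" where
  "trail V E q \<longleftrightarrow> walk V E q \<and> distinct (walk_edges q)"

definition circuit :: "'a set \<Rightarrow> 'a set set \<Rightarrow> 'a list \<Rightarrow> bool" where
  "circuit V E q \<longleftrightarrow> trail V E q \<and> hd q = last q"

definition graph_connected :: "'a set \<Rightarrow> 'a set set \<Rightarrow> bool" where
  "graph_connected V E \<longleftrightarrow>
     V \<noteq> {} \<and> (\<forall>u\<in>V. \<forall>v\<in>V. \<exists>p. walk V E p \<and> hd p = u \<and> last p = v)"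

definition edge_connected :: "nat \<Rightarrow> 'a set \<Rightarrow> 'a set set \<Rightarrow> bool" where
  "edge_connected l V E \<longleftrightarrow>
     card V \<ge> 2 \<and> (\<forall>F \<subseteq> E. card F < l \<longrightarrow> graph_connected V (E - F))"

definition shortest_circuit_through ::
    "'a set \<Rightarrow> 'a set set \<Rightarrow> 'a set set \<Rightarrow> 'a list \<Rightarrow> bool" where
  "shortest_circuit_through V E F H \<longleftrightarrow>
     circuit V E H \<and> F \<subseteq> edges_of H \<and>
     (\<forall>C. circuit V E C \<and> F \<subseteq> edges_of C \<longrightarrow> length (walk_edges H) \<le> length (walk_edges C))"

text \<open>
  \<open>H = H\<^sub>1 e\<^sub>1 H\<^sub>2 e\<^sub>2 \<dots> H\<^sub>k e\<^sub>k\<close>: the circuit is based at the first vertex of \<open>H\<^sub>1\<close>, and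
  \<open>e\<^sub>j\<close> joins the last vertex of \<open>H\<^sub>j\<close> to the first vertex of the cyclically next segment.
  That each \<open>H\<^sub>j\<close> is a path is not demanded: it follows when \<open>H\<close> is a shortest circuit
  through \<open>e\<^sub>1, \<dots>, e\<^sub>k\<close>.
\<close>

definition segmentation :: "nat \<Rightarrow> (nat \<Rightarrow> 'a set) \<Rightarrow> (nat \<Rightarrow> 'a list) \<Rightarrow> 'a list \<Rightarrow> bool" where
  "segmentation k e Hs H \<longleftrightarrow>
     (\<forall>j\<in>{1..k}. Hs j \<noteq> []) \<and>
     H = concat (map Hs [1..<Suc k]) @ [hd (Hs 1)] \<and>
     (\<forall>j\<in>{1..k}. e j = {last (Hs j), hd (Hs (if j = k then 1 else Suc j))})"

definition subtrail_at :: "'a list \<Rightarrow> 'a list \<Rightarrow> nat set \<Rightarrow> bool" where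
  "subtrail_at p q I \<longleftrightarrow>
     (p = [] \<and> I = {}) \<or>
     (\<exists>t r. length p = Suc r \<and> t + r < length q \<and> I = {t..t + r} \<and>
        ((\<forall>h\<le>r. p ! h = q ! (t + h)) \<or> (\<forall>h\<le>r. p ! h = q ! (t + r - h))))"

text \<open>
  \<open>cl_seg S U\<close> is \<open>Cl\<^sub>j(U)\<close> for \<open>S = H\<^sub>j\<close>; the order \<open><\<^sub>j\<close> is the order of list positions in \<open>S\<close>.
\<close>

definition cl_seg :: "'a list \<Rightarrow> 'a set \<Rightarrow> 'a list" where
  "cl_seg S U =
     (let Ins = {i. i < length S \<and> S ! i \<in> U}
      in if Ins = {} then [] else take (Suc (Max Ins - Min Ins)) (drop (Min Ins) S))"

definition cl :: "nat \<Rightarrow> (nat \<Rightarrow> 'a list) \<Rightarrow> 'a set \<Rightarrow> 'a set" where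
  "cl k Hs U = (\<Union>j\<in>{1..k}. set (cl_seg (Hs j) U))"

text \<open>In the following, \<open>f\<close> stands for the edge \<open>e\<^sub>k\<^sub>+\<^sub>1\<close>.\<close>

definition admissible ::
    "'a set \<Rightarrow> 'a set set \<Rightarrow> 'a list \<Rightarrow> 'a set \<Rightarrow> 'a \<Rightarrow> 'a \<Rightarrow> 'a list \<Rightarrow> bool" where
  "admissible V E H f x y p \<longleftrightarrow>
     trail V (E - edges_of H - {f}) p \<and> hd p = x \<and> last p = y \<and> set p \<inter> set H \<subseteq> {x, y}"

definition reach :: "'a set \<Rightarrow> 'a set set \<Rightarrow> 'a list \<Rightarrow> 'a set \<Rightarrow> 'a set \<Rightarrow> 'a set" where
  "reach V E H f X = {y \<in> set H. \<exists>x\<in>X. \<exists>p. admissible V E H f x y p}"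

text \<open>\<open>layer \<dots> v i\<close> is \<open>A\<^sub>i\<close> for \<open>v = a\<close> and \<open>B\<^sub>i\<close> for \<open>v = b\<close>.\<close>

fun layer ::
    "'a set \<Rightarrow> 'a set set \<Rightarrow> nat \<Rightarrow> (nat \<Rightarrow> 'a list) \<Rightarrow> 'a list \<Rightarrow> 'a set \<Rightarrow> 'a \<Rightarrow> nat \<Rightarrow> 'a set" where
  "layer V E k Hs H f v 0 = {}"
| "layer V E k Hs H f v (Suc 0) = reach V E H f {v}"
| "layer V E k Hs H f v (Suc (Suc i)) = reach V E H f (cl k Hs (layer V E k Hs H f v (Suc i)))"

definition coherent ::
    "'a set \<Rightarrow> 'a set set \<Rightarrow> nat \<Rightarrow> (nat \<Rightarrow> 'a set) \<Rightarrow> 'a \<Rightarrow> 'a \<Rightarrow> (nat \<Rightarrow> 'a list) \<Rightarrow> 'a list \<Rightarrow>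
     nat \<Rightarrow> nat \<Rightarrow> 'a list \<Rightarrow> bool" where
  "coherent V E k e a b Hs H n m q \<longleftrightarrow>
     (let f = e (Suc k);
          w = length q - 1;
          A = layer V E k Hs H f a;
          B = layer V E k Hs H f b
      in trail V E q \<and>
         (\<forall>i\<in>{1..k}. e i \<in> edges_of q) \<and> q ! 0 \<in> A (n + 1) \<and> q ! w \<in> B (m + 1) \<and>
         (\<forall>s\<in>{1..w}. {q ! (s - 1), q ! s} \<in> E - edges_of H \<longrightarrow>
            (\<exists>r t. r < s \<and> s \<le> t \<and> t \<le> w \<and> q ! r \<in> set H \<and> q ! t \<in> set H \<and>
               admissible V E H f (q ! r) (q ! t) (take (Suc (t - r)) (drop r q)) \<and>
               \<not> (q ! r \<in> A (n + 1) \<and> q ! t \<in> A (n + 1)) \<and>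
               \<not> (q ! r \<in> B (m + 1) \<and> q ! t \<in> B (m + 1)))) \<and>
         (\<exists>IA IB :: nat \<Rightarrow> nat set.
            (\<forall>j\<in>{1..k}. subtrail_at (cl_seg (Hs j) (A n)) q (IA j) \<and>
                        subtrail_at (cl_seg (Hs j) (B m)) q (IB j)) \<and>
            (\<forall>j\<in>{1..k}. \<forall>j'\<in>{1..k}. j \<noteq> j' \<longrightarrow>
               (\<forall>I\<in>{IA, IB}. \<forall>J\<in>{IA, IB}. I j \<inter> J j' = {}))))"

end

theory Submission
  imports Defs "HOL-Library.Sublist"
begin

text \<open>
  The proof is a descent on \<open>n + m\<close>. Let \<open>Q\<close> be \<open>A\<^sub>n\<close>-\<open>B\<^sub>m\<close>-coherent with \<open>n \<ge> 1\<close>.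

  If some segment \<open>H\<^sub>j\<close> meets both \<open>A\<^sub>n\<close> and \<open>B\<^sub>m\<^sub>+\<^sub>1\<close>, take the least \<open>c\<close> and \<open>d\<close> such that \<open>H\<^sub>j\<close>
  meets \<open>A\<^sub>c\<^sub>+\<^sub>1\<close> and \<open>B\<^sub>d\<^sub>+\<^sub>1\<close>. Cutting the circuit \<open>H\<close> open between a vertex of \<open>A\<^sub>c\<^sub>+\<^sub>1\<close> and one of
  \<open>B\<^sub>d\<^sub>+\<^sub>1\<close> on \<open>H\<^sub>j\<close> yields an \<open>A\<^sub>c\<close>-\<open>B\<^sub>d\<close>-coherent trail, since \<open>H\<^sub>j\<close> misses \<open>A\<^sub>c\<close> and \<open>B\<^sub>d\<close>.

  Otherwise \<open>Q\<close> is rotated at its first vertex \<open>q\<^sub>0\<close>, which may be assumed to lie outside \<open>A\<^sub>n\<close>: an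
  admissible path \<open>P\<close> joins \<open>q\<^sub>0\<close> to a vertex \<open>q\<^sub>s\<close> of some \<open>Cl\<^sub>j(A\<^sub>n)\<close>, and it shares no edge with \<open>Q\<close>,
  because both ends of an excursion of \<open>Q\<close> that it touches would lie in \<open>A\<^sub>n\<^sub>+\<^sub>1\<close>. If \<open>q\<^sub>i\<close> is the last
  vertex of \<open>A\<^sub>n\<close> before \<open>q\<^sub>s\<close> on \<open>Cl\<^sub>j(A\<^sub>n)\<close>, then \<open>q\<^sub>i \<dots> q\<^sub>0 P q\<^sub>s \<dots> q\<^sub>w\<close> is \<open>A\<^sub>n\<^sub>-\<^sub>1\<close>-\<open>B\<^sub>m\<close>-coherent.
  The new excursion \<open>P\<close> obeys (C2) because \<open>q\<^sub>0\<close> is not in \<open>A\<^sub>n\<close> and \<open>q\<^sub>s\<close> is not in \<open>B\<^sub>m\<^sub>+\<^sub>1\<close>.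
  The case \<open>m \<ge> 1\<close> is symmetric under reversal.
\<close>

subsection \<open>Walks as lists\<close>

lemma last_join: "xs \<noteq> [] \<Longrightarrow> ys \<noteq> [] \<Longrightarrow> last xs = hd ys \<Longrightarrow> last (xs @ tl ys) = last ys"
  by (cases ys) auto

lemma set_tl_subset: "set (tl xs) \<subseteq> set xs"
  by (cases xs) auto

lemma nth_join:
  assumes "xs \<noteq> []" "last xs = hd ys" "h < length ys"
  shows "(xs @ tl ys) ! (length xs - 1 + h) = ys ! h"
  using assms by (cases xs rule: rev_cases; cases ys) simp_all

text \<open>Used for edge lists: when the stretch from \<open>i\<close> to \<open>j\<close> is cut
  out of a trail, an edge that does not occur in this stretch survives the cut.\<close>

lemma in_take_or_drop:
  assumes "x \<in> set xs" "\<And>h. i \<le> h \<Longrightarrow> h < j \<Longrightarrow> h < length xs \<Longrightarrow> xs ! h \<noteq> x"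
  shows "x \<in> set (take i xs) \<union> set (drop j xs)"
proof -
  obtain h where h: "h < length xs" "xs ! h = x" using assms(1) by (auto simp: in_set_conv_nth)
  then consider "h < i" | "j \<le> h" using assms(2)[of h] by linarith
  then show ?thesis
  proof cases
    case 1
    then show ?thesis using h by (auto simp: in_set_conv_nth intro!: exI[of _ h])
  next
    case 2
    then have "drop j xs ! (h - j) = x" "h - j < length (drop j xs)" using h by auto
    then show ?thesis using nth_mem[of "h - j" "drop j xs"] by simp
  qed
qed

lemma walk_edges_simps [simp]:
  "walk_edges [] = []" "walk_edges [x] = []"
  "walk_edges (x # y # zs) = {x, y} # walk_edges (y # zs)"
  by (simp_all add: walk_edges_def)

lemma length_walk_edges [simp]: "length (walk_edges q) = length q - 1"
  by (simp add: walk_edges_def)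

lemma nth_walk_edges: "Suc h < length q \<Longrightarrow> walk_edges q ! h = {q ! h, q ! Suc h}"
  by (simp add: walk_edges_def nth_tl)

lemma walk_edges_take: "walk_edges (take n q) = take (n - 1) (walk_edges q)"
proof (rule nth_equalityI)
  fix i assume "i < length (walk_edges (take n q))"
  then have "Suc i < length (take n q)" unfolding length_walk_edges by linarith
  then show "walk_edges (take n q) ! i = take (n - 1) (walk_edges q) ! i"
    by (subst nth_walk_edges) (auto simp: nth_walk_edges)
qed auto

lemma walk_edges_drop: "walk_edges (drop n q) = drop n (walk_edges q)"
  by (rule nth_equalityI) (auto simp: nth_walk_edges)

lemma walk_edges_join:
  "xs \<noteq> [] \<Longrightarrow> ys \<noteq> [] \<Longrightarrow> last xs = hd ys \<Longrightarrow>
   walk_edges (xs @ tl ys) = walk_edges xs @ walk_edges ys"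
proof (induction xs rule: induct_list012)
  case (2 x)
  then show ?case by (cases ys) auto
qed auto

lemma walk_edges_snoc: "walk_edges (xs @ [x, y]) = walk_edges (xs @ [x]) @ [{x, y}]"
  using walk_edges_join[of "xs @ [x]" "[x, y]"] by simp

lemma walk_edges_rev: "walk_edges (rev q) = rev (walk_edges q)"
proof (induction q rule: induct_list012)
  case (3 x y zs)
  then show ?case by (simp add: walk_edges_snoc insert_commute)
qed auto

lemma edges_of_rev: "edges_of (rev q) = edges_of q"
  by (simp add: walk_edges_rev)

lemma sublist_walk_edges:
  assumes "sublist p q"
  shows "sublist (walk_edges p) (walk_edges q)"
proof -
  obtain xs zs where "q = xs @ p @ zs" using assms by (auto simp: sublist_def)
  then have "take (length p) (drop (length xs) q) = p" by simp
  from arg_cong[OF this, of walk_edges]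
  have "take (length p - 1) (drop (length xs) (walk_edges q)) = walk_edges p"
    by (simp only: walk_edges_take walk_edges_drop)
  then show ?thesis
    using sublist_order.order_trans[OF sublist_take sublist_drop] by metis
qed

lemma edge_of_walk_subset: "g \<in> edges_of q \<Longrightarrow> g \<subseteq> set q"
  by (induction q rule: induct_list012) auto

lemma distinct_walk_edges: "distinct q \<Longrightarrow> distinct (walk_edges q)"
proof (induction q rule: induct_list012)
  case (3 x y zs)
  then show ?case using edge_of_walk_subset[of "{x, y}" "y # zs"] by auto
qed auto

lemma walk_sublist: "walk V E q \<Longrightarrow> sublist p q \<Longrightarrow> p \<noteq> [] \<Longrightarrow> walk V E p"
  unfolding walk_def
  using set_mono_sublist[of p q] set_mono_sublist[OF sublist_walk_edges[of p q]] by auto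

lemma walk_rev: "walk V E q \<Longrightarrow> walk V E (rev q)"
  by (simp add: walk_def walk_edges_rev)

lemma walk_join:
  "walk V E p \<Longrightarrow> walk V E q \<Longrightarrow> last p = hd q \<Longrightarrow> walk V E (p @ tl q)"
  unfolding walk_def using walk_edges_join[of p q] by (cases q) auto

text \<open>Closed parts between two visits of a vertex are cut out, by induction on the length. No
  new vertex appears, so a bound on the vertices shared with \<open>H\<close> is inherited by the
  path.\<close>

lemma walk_to_path:
  assumes "walk V E q"
  obtains p where "walk V E p" "distinct p" "hd p = hd q" "last p = last q" "set p \<subseteq> set q"
proof -
  have "\<exists>p. walk V E p \<and> distinct p \<and> hd p = hd q \<and> last p = last q \<and> set p \<subseteq> set q"
    using assms
  proof (induction "length q" arbitrary: q rule: less_induct)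
    case less
    show ?case
    proof (cases "distinct q")
      case False
      then obtain xs ys zs y where q: "q = xs @ [y] @ ys @ [y] @ zs"
        using not_distinct_decomp by blast
      let ?r = "(xs @ [y]) @ tl (y # zs)"
      have "sublist (xs @ [y]) q" unfolding q sublist_def
        by (intro exI[of _ "[]"] exI[of _ "ys @ [y] @ zs"]) simp
      moreover have "sublist (y # zs) q" unfolding q sublist_def
        by (intro exI[of _ "xs @ [y] @ ys"] exI[of _ "[]"]) simp
      ultimately have "walk V E (xs @ [y])" "walk V E (y # zs)"
        using less.prems by (auto intro: walk_sublist)
      then have "walk V E ?r" by (intro walk_join) auto
      moreover have "length ?r < length q" using q by simp
      ultimately obtain p where "walk V E p" "distinct p" "hd p = hd ?r" "last p = last ?r"
        "set p \<subseteq> set ?r"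
        using less.hyps by blast
      moreover have "hd ?r = hd q" "last ?r = last q" "set ?r \<subseteq> set q"
        unfolding q by (cases xs; simp) (simp, auto)
      ultimately show ?thesis by auto
    qed (use less.prems in blast)
  qed
  then show thesis using that by blast
qed

subsection \<open>Positions of subtrails\<close>

text \<open>
  Weaker than disjointness of intervals: a common end point is allowed. This is stable under
  rotation along a trivial path, which merges two positions of the trail.
\<close>

definition sep :: "nat set \<Rightarrow> nat set \<Rightarrow> bool" where
  "sep I J \<longleftrightarrow> (\<forall>x\<in>I. \<forall>y\<in>J. x \<le> y) \<or> (\<forall>x\<in>I. \<forall>y\<in>J. y \<le> x)"

lemma sep_commute: "sep I J \<longleftrightarrow> sep J I"
  by (auto simp: sep_def)

lemma sep_subset: "sep I J \<Longrightarrow> I' \<subseteq> I \<Longrightarrow> J' \<subseteq> J \<Longrightarrow> sep I' J'"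
  unfolding sep_def by (meson subsetD)

lemma sep_empty [simp]: "sep {} J" "sep J {}"
  by (auto simp: sep_def)

lemma disjoint_convex_sep:
  assumes "I \<inter> J = {}"
    and I: "\<And>x y z. x \<in> I \<Longrightarrow> y \<in> I \<Longrightarrow> x \<le> z \<Longrightarrow> z \<le> y \<Longrightarrow> z \<in> I"
    and J: "\<And>x y z. x \<in> J \<Longrightarrow> y \<in> J \<Longrightarrow> x \<le> z \<Longrightarrow> z \<le> y \<Longrightarrow> z \<in> J"
  shows "sep I J"
proof (rule ccontr)
  assume "\<not> sep I J"
  \<comment> \<open>Unseparated sets contain pairs in both orders. Comparing the left elements
    \<open>x'\<close> and \<open>y\<close>, the larger one falls between two elements of the other
    set.\<close>
  then obtain x y x' y' where xy: "x \<in> I" "y \<in> J" "y < x" "x' \<in> I" "y' \<in> J" "x' < y'"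
    unfolding sep_def by (auto simp: not_le)
  have "x' \<notin> J" "y \<notin> I" using xy assms(1) by auto
  then have "\<not> y \<le> x'" "\<not> x' \<le> y" using xy I[of x' x y] J[of y y' x'] by auto
  then show False by simp
qed

lemma subtrail_at_Nil: "subtrail_at [] q I \<longleftrightarrow> I = {}"
  by (auto simp: subtrail_at_def)

lemma subtrail_at_empty: "subtrail_at p q {} \<Longrightarrow> p = []"
  by (auto simp: subtrail_at_def)

lemma subtrail_at_interval:
  assumes "subtrail_at p q I" "p \<noteq> []"
  obtains t r where "length p = Suc r" "t + r < length q" "I = {t..t + r}"
    "(\<forall>h\<le>r. p ! h = q ! (t + h)) \<or> (\<forall>h\<le>r. p ! h = q ! (t + r - h))"
  using assms by (auto simp: subtrail_at_def)

lemma subtrail_at_convex: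
  "subtrail_at p q I \<Longrightarrow> x \<in> I \<Longrightarrow> y \<in> I \<Longrightarrow> x \<le> z \<Longrightarrow> z \<le> y \<Longrightarrow> z \<in> I"
  by (auto simp: subtrail_at_def)

lemma subtrail_at_less: "subtrail_at p q I \<Longrightarrow> x \<in> I \<Longrightarrow> x < length q"
  by (auto simp: subtrail_at_def)

text \<open>Used in both directions: to find a position in the trail for a given vertex of a
  closure, and to see that a trail stays on \<open>H\<close> throughout a witnessing
  interval.\<close>

lemma subtrail_at_vertices:
  assumes "subtrail_at p q I"
  shows "(!) q ` I = set p"
proof (cases "p = []")
  case False
  obtain t r where r: "length p = Suc r" "I = {t..t + r}"
    "(\<forall>h\<le>r. p ! h = q ! (t + h)) \<or> (\<forall>h\<le>r. p ! h = q ! (t + r - h))"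
    using subtrail_at_interval[OF assms False] by metis
  have I: "I = (\<lambda>h. t + h) ` {..r}" "I = (\<lambda>h. t + r - h) ` {..r}"
  proof -
    have "x \<in> (\<lambda>h. t + h) ` {..r}" "x \<in> (\<lambda>h. t + r - h) ` {..r}" if "x \<in> I" for x
      using that r(2) image_eqI[of x "\<lambda>h. t + h" "x - t"] image_eqI[of x "\<lambda>h. t + r - h" "t + r - x"]
      by auto
    then show "I = (\<lambda>h. t + h) ` {..r}" "I = (\<lambda>h. t + r - h) ` {..r}" using r(2) by auto
  qed
  have p: "set p = (!) p ` {..r}"
    using r(1) by (auto simp: in_set_conv_nth less_Suc_eq_le)
  show ?thesis using r(3)
  proof
    assume "\<forall>h\<le>r. p ! h = q ! (t + h)"
    then show ?thesis unfolding p I(1) image_image by (intro image_cong) auto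
  next
    assume "\<forall>h\<le>r. p ! h = q ! (t + r - h)"
    then show ?thesis unfolding p I(2) image_image by (intro image_cong) auto
  qed
qed (use assms in \<open>auto simp: subtrail_at_def\<close>)

text \<open>Makes deletion safe: an edge of the trail inside the interval of a closure is an edge of
  a segment, hence none of the \<open>e i\<close>.\<close>

lemma subtrail_at_edge:
  assumes "subtrail_at p q I" "h \<in> I" "Suc h \<in> I"
  shows "{q ! h, q ! Suc h} \<in> edges_of p"
proof -
  have "p \<noteq> []" using assms by (auto simp: subtrail_at_def)
  then obtain t r where r: "length p = Suc r" "I = {t..t + r}"
    "(\<forall>h\<le>r. p ! h = q ! (t + h)) \<or> (\<forall>h\<le>r. p ! h = q ! (t + r - h))"
    using subtrail_at_interval[OF assms(1)] by metis
  have "\<exists>i. Suc i < length p \<and> {q ! h, q ! Suc h} = {p ! i, p ! Suc i}"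
    using r(3)
  proof
    assume "\<forall>h\<le>r. p ! h = q ! (t + h)"
    then show ?thesis using assms r(1,2) by (intro exI[of _ "h - t"]) (auto simp: Suc_diff_le)
  next
    assume *: "\<forall>h\<le>r. p ! h = q ! (t + r - h)"
    \<comment> \<open>In the reversed reading the edge is traversed backwards, so its first vertex
      in \<open>p\<close> is the one at \<open>Suc h\<close> in \<open>q\<close>.\<close>
    let ?i = "t + r - Suc h"
    have "t + r - ?i = Suc h" "t + r - Suc ?i = h" "Suc ?i \<le> r"
      using assms r(2) by auto
    then have "p ! ?i = q ! Suc h" "p ! Suc ?i = q ! h" using * by auto
    then show ?thesis using r(1) \<open>Suc ?i \<le> r\<close> by (intro exI[of _ ?i]) auto
  qed
  then obtain i where "Suc i < length p" "{q ! h, q ! Suc h} = walk_edges p ! i"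
    by (auto simp: nth_walk_edges)
  then show ?thesis by simp
qed

text \<open>The form \<open>h + c - d\<close> covers moves to the right and to the left in one
  formula on naturals; \<open>d \<le> h + c\<close> excludes truncation.\<close>

lemma subtrail_at_shift:
  assumes "subtrail_at p q I"
    and "\<And>h. h \<in> I \<Longrightarrow> d \<le> h + c \<and> h + c - d < length q' \<and> q' ! (h + c - d) = q ! h"
  shows "subtrail_at p q' ((\<lambda>h. h + c - d) ` I)"
proof (cases "p = []")
  case False
  obtain t r where r: "length p = Suc r" "t + r < length q" "I = {t..t + r}"
    "(\<forall>h\<le>r. p ! h = q ! (t + h)) \<or> (\<forall>h\<le>r. p ! h = q ! (t + r - h))"
    using subtrail_at_interval[OF assms(1) False] by metis
  define t' where "t' = t + c - d"
  have d: "d \<le> t + c" using assms(2)[of t] r(3) by simp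
  have img: "(\<lambda>h. h + c - d) ` I = {t'..t' + r}"
  proof (intro set_eqI iffI)
    fix x assume "x \<in> {t'..t' + r}"
    then show "x \<in> (\<lambda>h. h + c - d) ` I"
      unfolding r(3) t'_def using d by (intro image_eqI[of _ _ "x + d - c"]) auto
  qed (use d in \<open>auto simp: r(3) t'_def\<close>)
  have eq: "q' ! (t' + h) = q ! (t + h)" if "h \<le> r" for h
    using assms(2)[of "t + h"] that d r(3) by (auto simp: t'_def add.commute add.left_commute)
  have "t' + r < length q'"
    using assms(2)[of "t + r"] d r(3) by (auto simp: t'_def)
  moreover have "(\<forall>h\<le>r. p ! h = q' ! (t' + h)) \<or> (\<forall>h\<le>r. p ! h = q' ! (t' + r - h))"
    using r(4)
  proof
    assume *: "\<forall>h\<le>r. p ! h = q ! (t + r - h)"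
    have "p ! h = q' ! (t' + r - h)" if "h \<le> r" for h
      using that * eq[of "r - h"] by simp
    then show ?thesis by blast
  qed (simp add: eq)
  ultimately show ?thesis unfolding img subtrail_at_def using r(1) by blast
qed (use assms in \<open>auto simp: subtrail_at_def\<close>)

text \<open>For a part of the trail that gets reversed. The two orientations permitted in
  \<open>subtrail_at\<close> are exchanged.\<close>

lemma subtrail_at_reflect:
  assumes "subtrail_at p q I"
    and "\<And>h. h \<in> I \<Longrightarrow> h \<le> l \<and> l - h < length q' \<and> q' ! (l - h) = q ! h"
  shows "subtrail_at p q' ((\<lambda>h. l - h) ` I)"
proof (cases "p = []")
  case False
  obtain t r where r: "length p = Suc r" "t + r < length q" "I = {t..t + r}"
    "(\<forall>h\<le>r. p ! h = q ! (t + h)) \<or> (\<forall>h\<le>r. p ! h = q ! (t + r - h))"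
    using subtrail_at_interval[OF assms(1) False] by metis
  define t' where "t' = l - (t + r)"
  have l: "t + r \<le> l" using assms(2)[of "t + r"] r(3) by simp
  have img: "(\<lambda>h. l - h) ` I = {t'..t' + r}"
  proof (intro set_eqI iffI)
    fix x assume "x \<in> {t'..t' + r}"
    then show "x \<in> (\<lambda>h. l - h) ` I"
      unfolding r(3) t'_def using l by (intro image_eqI[of _ _ "l - x"]) auto
  qed (use l in \<open>auto simp: r(3) t'_def\<close>)
  have eq: "q' ! (t' + h) = q ! (t + r - h)" if "h \<le> r" for h
  proof -
    have "l - (t + r - h) = t' + h" using l that by (simp add: t'_def)
    then show ?thesis using assms(2)[of "t + r - h"] that r(3) by simp
  qed
  have "t' + r < length q'"
    using assms(2)[of t] l r(3) by (auto simp: t'_def)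
  moreover have "(\<forall>h\<le>r. p ! h = q' ! (t' + h)) \<or> (\<forall>h\<le>r. p ! h = q' ! (t' + r - h))"
    using r(4)
  proof
    assume *: "\<forall>h\<le>r. p ! h = q ! (t + h)"
    have "p ! h = q' ! (t' + r - h)" if "h \<le> r" for h
      using that * eq[of "r - h"] by simp
    then show ?thesis by blast
  qed (simp add: eq)
  ultimately show ?thesis unfolding img subtrail_at_def using r(1) by blast
qed (use assms in \<open>auto simp: subtrail_at_def\<close>)

lemma subtrail_at_sublist:
  assumes "subtrail_at p q I" "sublist p' p"
  shows "\<exists>I'\<subseteq>I. subtrail_at p' q I'"
proof (cases "p' = []")
  case True
  then show ?thesis by (auto simp: subtrail_at_Nil)
next
  case False
  then have "p \<noteq> []" using assms(2) by auto
  then obtain t r where r: "length p = Suc r" "t + r < length q" "I = {t..t + r}"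
    "(\<forall>h\<le>r. p ! h = q ! (t + h)) \<or> (\<forall>h\<le>r. p ! h = q ! (t + r - h))"
    using subtrail_at_interval[OF assms(1)] by metis
  obtain xs zs where p: "p = xs @ p' @ zs" using assms(2) by (auto simp: sublist_def)
  obtain r' where r': "length p' = Suc r'" using False by (cases p') auto
  have len: "length xs + r' + length zs = r" using r(1) r' p by simp
  have nth: "p' ! h = p ! (length xs + h)" if "h \<le> r'" for h
    using that r' by (simp add: p nth_append)
  show ?thesis using r(4)
  proof
    assume *: "\<forall>h\<le>r. p ! h = q ! (t + h)"
    let ?t = "t + length xs"
    have "\<forall>h\<le>r'. p' ! h = q ! (?t + h)"
      using * nth len by (simp add: add.assoc)
    then have "subtrail_at p' q {?t..?t + r'}"
      unfolding subtrail_at_def using r' r(2) len by (intro disjI2 exI[of _ ?t] exI[of _ r']) auto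
    then show ?thesis using r(3) len by (intro exI[of _ "{?t..?t + r'}"]) auto
  next
    assume *: "\<forall>h\<le>r. p ! h = q ! (t + r - h)"
    \<comment> \<open>Read backwards, the part \<open>zs\<close> behind \<open>p'\<close> comes
      first in \<open>q\<close>.\<close>
    let ?t = "t + length zs"
    have "t + r - (length xs + h) = ?t + r' - h" if "h \<le> r'" for h
      using len that by simp
    then have "\<forall>h\<le>r'. p' ! h = q ! (?t + r' - h)"
      using * nth len by (metis (no_types, lifting) add.assoc add_leD1 add_le_cancel_left le_trans nat_le_iff_add)
    then have "subtrail_at p' q {?t..?t + r'}"
      unfolding subtrail_at_def using r' r(2) len by (intro disjI2 exI[of _ ?t] exI[of _ r']) auto
    then show ?thesis using r(3) len by (intro exI[of _ "{?t..?t + r'}"]) auto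
  qed
qed

section \<open>Closures inside a single segment\<close>

lemma cl_seg_cases:
  obtains "cl_seg S U = []" "U \<inter> set S = {}"
  | i j where "i \<le> j" "j < length S" "S ! i \<in> U" "S ! j \<in> U"
      "\<And>h. h < length S \<Longrightarrow> S ! h \<in> U \<Longrightarrow> i \<le> h \<and> h \<le> j"
      "cl_seg S U = take (Suc (j - i)) (drop i S)"
proof (cases "{i. i < length S \<and> S ! i \<in> U} = {}")
  case True
  then show thesis using that(1) by (force simp: cl_seg_def in_set_conv_nth)
next
  case False
  let ?I = "{i. i < length S \<and> S ! i \<in> U}"
  have "Min ?I \<in> ?I" "Max ?I \<in> ?I" using False by (intro Min_in Max_in; simp)+
  moreover have "cl_seg S U = take (Suc (Max ?I - Min ?I)) (drop (Min ?I) S)"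
    using False unfolding cl_seg_def Let_def by (rule if_not_P)
  moreover have "Min ?I \<le> h \<and> h \<le> Max ?I" if "h \<in> ?I" for h
    using that by (intro conjI Min_le Max_ge) simp_all
  ultimately show thesis using that(2)[of "Min ?I" "Max ?I"] by auto
qed

lemma cl_seg_eq_Nil: "U \<inter> set S = {} \<Longrightarrow> cl_seg S U = []"
  by (cases rule: cl_seg_cases[of S U]) (auto dest: nth_mem)

lemma sublist_cl_seg: "sublist (cl_seg S U) S"
  by (cases rule: cl_seg_cases[of S U])
    (auto intro: sublist_order.order_trans[OF sublist_take sublist_drop])

lemma cl_seg_ends:
  assumes "cl_seg S U \<noteq> []"
  shows "hd (cl_seg S U) \<in> U" "last (cl_seg S U) \<in> U"
  using assms
  by (cases rule: cl_seg_cases[of S U]; auto simp: hd_drop_conv_nth last_conv_nth)+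

lemma subset_cl_seg: "U \<inter> set S \<subseteq> set (cl_seg S U)"
proof (cases rule: cl_seg_cases[of S U])
  case (2 i j)
  show ?thesis
  proof
    fix x assume "x \<in> U \<inter> set S"
    then obtain h where h: "h < length S" "S ! h = x" "i \<le> h" "h \<le> j"
      using 2(5) by (auto simp: in_set_conv_nth)
    then have "take (Suc (j - i)) (drop i S) ! (h - i) = x" 
      "h - i < length (take (Suc (j - i)) (drop i S))"
      using 2 by auto
    then show "x \<in> set (cl_seg S U)" unfolding 2 by (metis nth_mem)
  qed
qed auto

lemma cl_seg_mono:
  assumes "U \<subseteq> U'"
  shows "sublist (cl_seg S U) (cl_seg S U')"
proof (cases rule: cl_seg_cases[of S U])
  case (2 i j)
  note ij = 2
  show ?thesis
  proof (cases rule: cl_seg_cases[of S U'])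
    case 1
    then show ?thesis using ij assms by (auto dest: nth_mem)
  next
    case (2 i' j')
    have le: "i' \<le> i" "j \<le> j'" using ij 2(5) assms by (auto intro: le_less_trans)
    \<comment> \<open>The smaller closure starts \<open>i - i'\<close> places after the start of the
      larger one and ends no later.\<close>
    then have "cl_seg S U = take (Suc (j - i)) (drop (i - i') (cl_seg S U'))"
      unfolding ij(6) 2(6) drop_take take_take drop_drop using ij(1) 2(1) by (simp add: min_def)
    then show ?thesis
      using sublist_order.order_trans[OF sublist_take sublist_drop] by metis
  qed
qed auto

text \<open>A closure begins and ends in \<open>U\<close>, so in either orientation the extreme
  positions of its interval carry vertices of \<open>U\<close>.\<close>

lemma subtrail_at_cl_seg_ends:
  assumes "subtrail_at (cl_seg S U) q I" "I \<noteq> {}"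
  obtains t r where "I = {t..t + r}" "q ! t \<in> U" "q ! (t + r) \<in> U"
proof -
  have ne: "cl_seg S U \<noteq> []" using assms by (auto simp: subtrail_at_def)
  then obtain t r where r: "length (cl_seg S U) = Suc r" "I = {t..t + r}"
    "(\<forall>h\<le>r. cl_seg S U ! h = q ! (t + h)) \<or> (\<forall>h\<le>r. cl_seg S U ! h = q ! (t + r - h))"
    using subtrail_at_interval[OF assms(1)] by metis
  have "cl_seg S U ! 0 \<in> U" "cl_seg S U ! r \<in> U"
    using cl_seg_ends[OF ne] ne r(1) by (simp_all add: hd_conv_nth last_conv_nth)
  then show thesis using r(3) by (intro that[OF r(2)]) auto
qed

section \<open>Placing all closures in one trail\<close>

text \<open>The working form of (C3). The Boolean selects between the two families of closures, so
  that all four combinations are covered by one quantifier; \<open>sep\<close> replaces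
  disjointness.\<close>

definition placed :: "'j set \<Rightarrow> (bool \<Rightarrow> 'j \<Rightarrow> 'a list) \<Rightarrow> 'a list \<Rightarrow> bool" where
  "placed J C q \<longleftrightarrow> (\<exists>I. \<forall>b. \<forall>j\<in>J. subtrail_at (C b j) q (I b j) \<and>
     (\<forall>b'. \<forall>j'\<in>J. j \<noteq> j' \<longrightarrow> sep (I b j) (I b' j')))"

lemma sep_image_mono:
  "sep I J \<Longrightarrow> I \<union> J \<subseteq> X \<Longrightarrow> mono_on X f \<Longrightarrow> sep (f ` I) (f ` J)"
  unfolding sep_def mono_on_def by (elim disjE) (simp_all add: subset_iff)

lemma sep_image_antimono:
  "sep I J \<Longrightarrow> I \<union> J \<subseteq> X \<Longrightarrow> antimono_on X f \<Longrightarrow> sep (f ` I) (f ` J)"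
  unfolding sep_def monotone_on_def by (elim disjE) (simp_all add: subset_iff)

lemma placed_sublist:
  assumes "placed J C q" "\<And>b j. sublist (D b j) (C b j)"
  shows "placed J D q"
proof -
  obtain I where I: "\<And>b j. j \<in> J \<Longrightarrow> subtrail_at (C b j) q (I b j)"
    "\<And>b b' j j'. j \<in> J \<Longrightarrow> j' \<in> J \<Longrightarrow> j \<noteq> j' \<Longrightarrow> sep (I b j) (I b' j')"
    using assms(1) unfolding placed_def by blast
  have "\<forall>b. \<forall>j\<in>J. \<exists>K. K \<subseteq> I b j \<and> subtrail_at (D b j) q K"
    using subtrail_at_sublist[OF I(1) assms(2)] by simp
  then obtain K where "\<forall>b. \<forall>j\<in>J. K b j \<subseteq> I b j \<and> subtrail_at (D b j) q (K b j)"
    unfolding bchoice_iff choice_iff ..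
  moreover from this have "sep (K b j) (K b' j')" if "j \<in> J" "j' \<in> J" "j \<noteq> j'" for b b' j j'
    using sep_subset[OF I(2)[OF that, of b b']] that by simp
  ultimately show ?thesis unfolding placed_def by (intro exI[of _ K]) simp
qed

text \<open>The common tool for every change made to a trail: the positions up to \<open>lo\<close>
  are moved by \<open>f\<close>, possibly reversed, those from \<open>hi\<close> on by
  \<open>g\<close>, and the stretch in between is lost. Since no interval enters that stretch, each
  moves as a whole; pairs on the same side stay separated by monotonicity, pairs on different sides
  by \<open>fg\<close>.\<close>

lemma placed_splice:
  assumes sub: "\<And>b j. j \<in> J \<Longrightarrow> subtrail_at (C b j) q (I b j)"
    and sep: "\<And>b b' j j'. j \<in> J \<Longrightarrow> j' \<in> J \<Longrightarrow> j \<noteq> j' \<Longrightarrow> sep (I b j) (I b' j')"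
    and side: "\<And>b j. j \<in> J \<Longrightarrow> I b j \<subseteq> {..lo} \<or> I b j \<subseteq> {hi..}"
    and f: "\<And>p I. subtrail_at p q I \<Longrightarrow> I \<subseteq> {..lo} \<Longrightarrow> subtrail_at p r (f ` I)"
    and g: "\<And>p I. subtrail_at p q I \<Longrightarrow> I \<subseteq> {hi..} \<Longrightarrow> subtrail_at p r (g ` I)"
    and mf: "mono_on {..lo} f \<or> antimono_on {..lo} f"
    and mg: "mono_on {hi..} g"
    and fg: "sep (f ` {..lo}) (g ` {hi..<length q})"
  shows "placed J C r"
proof -
  \<comment> \<open>If \<open>lo = hi\<close>, an interval may lie on both sides; \<open>f\<close>
    then takes precedence.\<close>
  define I' where "I' b j = (if I b j \<subseteq> {..lo} then f ` I b j else g ` I b j)" for b j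
  have "subtrail_at (C b j) r (I' b j)" if "j \<in> J" for b j
    using f[OF sub[OF that, of b]] g[OF sub[OF that, of b]] side[OF that, of b]
    by (simp add: I'_def) blast
  moreover have "sep (I' b j) (I' b' j')" if j: "j \<in> J" "j' \<in> J" "j \<noteq> j'" for b b' j j'
  proof -
    have up: "I c i \<subseteq> {hi..<length q}" if "i \<in> J" "\<not> I c i \<subseteq> {..lo}" for c i
      using side[of i c] subtrail_at_less[OF sub[OF that(1), of c]] that by auto
    consider "I b j \<subseteq> {..lo}" "I b' j' \<subseteq> {..lo}" | "I b j \<subseteq> {..lo}" "\<not> I b' j' \<subseteq> {..lo}"
      | "\<not> I b j \<subseteq> {..lo}" "I b' j' \<subseteq> {..lo}" | "\<not> I b j \<subseteq> {..lo}" "\<not> I b' j' \<subseteq> {..lo}"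
      by blast
    then show ?thesis
    proof cases
      case 1
      then have "sep (f ` I b j) (f ` I b' j')"
        using mf sep_image_mono[OF sep[OF j, of b b'], of "{..lo}" f]
          sep_image_antimono[OF sep[OF j, of b b'], of "{..lo}" f] by blast
      then show ?thesis using 1 by (simp add: I'_def)
    next
      case 2
      then have "sep (f ` I b j) (g ` I b' j')"
        using up[OF j(2)] by (intro sep_subset[OF fg] image_mono)
      then show ?thesis using 2 by (simp add: I'_def)
    next
      case 3
      then have "sep (f ` I b' j') (g ` I b j)"
        using up[OF j(1)] by (intro sep_subset[OF fg] image_mono)
      then show ?thesis using 3 by (simp add: I'_def sep_commute)
    next
      case 4
      have "I b j \<union> I b' j' \<subseteq> {hi..}" using up[of j b] up[of j' b'] j 4 by auto
      then show ?thesis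
        using 4 sep_image_mono[OF sep[OF j, of b b'] _ mg] by (simp add: I'_def)
    qed
  qed
  ultimately show ?thesis unfolding placed_def by (intro exI[of _ I']) simp
qed

subsection \<open>Ears\<close>

text \<open>
  An ear is an excursion off \<open>H\<close> that is minimal, so that no cut of a trail at a vertex of \<open>H\<close>
  can split it; the excursions in (C2) need not be minimal.
\<close>

definition ear :: "'a list \<Rightarrow> 'a \<Rightarrow> 'a list \<Rightarrow> 'a \<Rightarrow> bool" where
  "ear H u ys v \<longleftrightarrow> u \<in> set H \<and> v \<in> set H \<and> set ys \<inter> set H = {} \<and>
     \<not> edges_of (u # ys @ [v]) \<subseteq> edges_of H"

definition ears :: "'a list \<Rightarrow> ('a \<Rightarrow> 'a list \<Rightarrow> 'a \<Rightarrow> bool) \<Rightarrow> 'a list \<Rightarrow> bool" where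
  "ears H C q \<longleftrightarrow> (\<forall>u ys v. sublist (u # ys @ [v]) q \<longrightarrow> ear H u ys v \<longrightarrow> C u ys v)"

lemma ear_rev: "ear H v (rev ys) u \<longleftrightarrow> ear H u ys v"
  using edges_of_rev[of "u # ys @ [v]"] by (auto simp: ear_def)

text \<open>An ear without inner vertices is a single edge, off \<open>H\<close> by definition.
  Otherwise each of its edges contains an inner vertex, and those avoid \<open>H\<close>.\<close>

lemma ear_edges_off:
  assumes "ear H u ys v"
  shows "edges_of (u # ys @ [v]) \<inter> edges_of H = {}"
proof (cases "ys = []")
  case True
  then show ?thesis using assms by (auto simp: ear_def)
next
  case False
  have "g \<inter> set ys \<noteq> {}" if g: "g \<in> edges_of (u # ys @ [v])" for g
  proof -
    let ?q = "u # ys @ [v]"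
    obtain h where "h < length (walk_edges ?q)" "g = walk_edges ?q ! h"
      using g unfolding in_set_conv_nth by metis
    then have h: "h < length ys + 1" "g = {?q ! h, ?q ! Suc h}"
      by (simp_all add: nth_walk_edges del: walk_edges_simps)
    show ?thesis
    \<comment> \<open>The last edge starts at the last inner vertex; each earlier edge ends at an
      inner vertex.\<close>
    proof (cases "h = length ys")
      case True
      then have "?q ! h = last ys" using False by (simp add: nth_append last_conv_nth nth_Cons')
      then show ?thesis using h False by auto
    next
      case False
      then have "?q ! Suc h = ys ! h" using h by (simp add: nth_append)
      then show ?thesis using h False nth_mem[of h ys] by auto
    qed
  qed
  then show ?thesis using assms edge_of_walk_subset[of _ H] by (fastforce simp: ear_def)
qed

lemma ears_sublist: "ears H C q \<Longrightarrow> sublist p q \<Longrightarrow> ears H C p"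
  unfolding ears_def using sublist_order.order_trans by blast

lemma ears_weaken:
  "ears H C q \<Longrightarrow> (\<And>u ys v. ear H u ys v \<Longrightarrow> C u ys v \<Longrightarrow> D u ys v) \<Longrightarrow> ears H D q"
  unfolding ears_def by blast

lemma ears_rev:
  assumes "ears H C q" "\<And>u ys v. C u ys v \<Longrightarrow> D v (rev ys) u"
  shows "ears H D (rev q)"
  unfolding ears_def
proof (intro allI impI)
  fix u ys v assume "sublist (u # ys @ [v]) (rev q)" "ear H u ys v"
  then have "sublist (v # rev ys @ [u]) q" "ear H v (rev ys) u"
    by (simp_all add: ear_rev sublist_rev_right)
  then have "C v (rev ys) u" using assms(1) unfolding ears_def by blast
  then show "D u ys v" using assms(2)[of v "rev ys" u] by simp
qed

text \<open>An ear running across the joint would have the joint as an inner vertex, but the joint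
  is on \<open>H\<close>. So gluing at a vertex of \<open>H\<close> creates no new ears.\<close>

lemma ears_join:
  assumes "ears H C xs" "ears H C ys" "xs \<noteq> []" "ys \<noteq> []" "last xs = hd ys" "hd ys \<in> set H"
  shows "ears H C (xs @ tl ys)"
  unfolding ears_def
proof (intro allI impI)
  fix u zs v assume s: "sublist (u # zs @ [v]) (xs @ tl ys)" and e: "ear H u zs v"
  obtain c xs0 ys0 where c: "xs = xs0 @ [c]" "ys = c # ys0" "c \<in> set H"
    using assms by (metis append_butlast_last_id list.exhaust_sel)
  have "sublist (u # zs @ [v]) (xs0 @ c # ys0)" using s c by simp
  then consider "sublist (u # zs @ [v]) xs0" | "sublist (u # zs @ [v]) ys"
    | p q where "u # zs @ [v] = p @ q" "suffix p xs0" "prefix q ys"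
    unfolding sublist_append c(2) by blast
  then have "sublist (u # zs @ [v]) xs \<or> sublist (u # zs @ [v]) ys"
  proof cases
    case 1
    then show ?thesis unfolding c(1) by (simp add: sublist_append)
  next
    case 3
    show ?thesis
    proof (cases "p = [] \<or> q = []")
      case True
      then show ?thesis using 3 unfolding c(1)
        by (auto simp: sublist_append intro: prefix_imp_sublist suffix_imp_sublist)
    next
      case False
      then obtain p' q' where p: "p = u # p'" and q: "q = c # q'"
        using 3 c(2) by (cases p; cases q) auto
      show ?thesis
      proof (cases "q' = []")
        case True
        have "suffix (p @ [c]) (xs0 @ [c])" using 3(2) by (auto simp: suffix_def)
        then have "sublist (p @ q) xs" using True q c(1) suffix_imp_sublist by auto
        then show ?thesis using 3(1) by simp
      next
        case F: False
        \<comment> \<open>The ear has vertices on both sides of the joint \<open>c\<close>, so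
          \<open>c\<close> is one of its inner vertices.\<close>
        then have "zs @ [v] = (p' @ c # butlast q') @ [last q']" using 3(1) p q by simp
        then have "c \<in> set zs" by (metis append1_eq_conv in_set_conv_decomp)
        then show ?thesis using e c(3) by (auto simp: ear_def)
      qed
    qed
  qed auto
  then show "C u zs v" using assms(1,2) e unfolding ears_def by blast
qed

lemma ears_subset: "edges_of q \<subseteq> edges_of H \<Longrightarrow> ears H C q"
  unfolding ears_def ear_def by (auto dest!: set_mono_sublist[OF sublist_walk_edges])

text \<open>From an edge off \<open>H\<close>, go back to the last previous vertex of
  \<open>H\<close> and forward to the next one; both exist because the trail starts and ends on
  \<open>H\<close>.\<close>

lemma ear_around:
  assumes "hd q \<in> set H" "last q \<in> set H" "0 < s" "s < length q"
    and "{q ! (s - 1), q ! s} \<notin> edges_of H"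
  obtains xs u ys v zs where "q = xs @ (u # ys @ [v]) @ zs" "ear H u ys v"
    "length xs < s" "s \<le> length xs + length ys + 1"
    "{q ! (s - 1), q ! s} \<in> edges_of (u # ys @ [v])"
proof -
  have "hd q \<in> set (take s q)" using assms by (metis hd_take hd_in_set gr_implies_not0 list.size(3) take_eq_Nil)
  then obtain xs u ys1 where 1: "take s q = xs @ u # ys1" "u \<in> set H" "\<forall>y\<in>set ys1. y \<notin> set H"
    using split_list_last_prop[of "take s q" "\<lambda>x. x \<in> set H"] assms(1) by metis
  have "last q \<in> set (drop s q)" using assms by (metis last_drop last_in_set drop_eq_Nil not_le)
  then obtain ys2 v zs where 2: "drop s q = ys2 @ v # zs" "v \<in> set H" "\<forall>y\<in>set ys2. y \<notin> set H"
    using split_list_first_prop[of "drop s q" "\<lambda>x. x \<in> set H"] assms(2) by metis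
  let ?ys = "ys1 @ ys2"
  have q: "q = xs @ (u # ?ys @ [v]) @ zs"
    using append_take_drop_id[of s q] 1(1) 2(1) by simp
  have s: "s = length xs + 1 + length ys1"
    using arg_cong[OF 1(1), of length] assms(4) by simp
  define p where "p = u # ?ys @ [v]"
  define h where "h = length ys1"
  have "q ! (length xs + i) = p ! i" if "i < length p" for i
    using that unfolding q p_def[symmetric] by (simp add: nth_append)
  from this[of h] this[of "Suc h"]
  have "{q ! (s - 1), q ! s} = walk_edges p ! h" and "h < length (walk_edges p)"
    by (simp_all add: s h_def p_def nth_walk_edges del: walk_edges_simps)
  then have g: "{q ! (s - 1), q ! s} \<in> edges_of p"
    by (metis nth_mem)
  then have "ear H u ?ys v"
    using 1 2 assms(5) unfolding ear_def p_def by auto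
  then show thesis using that[OF q] g s unfolding p_def by simp
qed

subsection \<open>Segmented circuits\<close>

locale segmented_circuit =
  fixes V :: "'a set" and E :: "'a set set" and k :: nat and e :: "nat \<Rightarrow> 'a set"
    and Hs :: "nat \<Rightarrow> 'a list" and H :: "'a list" and f :: "'a set"
  assumes simple: "simple_graph V E"
    and k_pos: "k \<ge> 1"
    and circuit_H: "circuit V E H"
    and segments: "segmentation k e Hs H"
begin

abbreviation L :: "'a \<Rightarrow> nat \<Rightarrow> 'a set" where
  "L \<equiv> layer V E k Hs H f"

text \<open>The index in \<open>H\<close> at which the block of \<open>Hs j\<close> starts;
  \<open>off (Suc k)\<close> is the index of the repeated base vertex.\<close>

definition off :: "nat \<Rightarrow> nat" where
  "off j = length (concat (map Hs [1..<j]))"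

lemma Hs_ne: "j \<in> {1..k} \<Longrightarrow> Hs j \<noteq> []"
  using segments by (simp add: segmentation_def)

lemma H_eq: "H = concat (map Hs [1..<Suc k]) @ [hd (Hs 1)]"
  using segments by (simp add: segmentation_def)

lemma H_ne: "H \<noteq> []" by (subst H_eq) simp

lemma hd_last_H: "hd H = last H"
  using circuit_H by (simp add: circuit_def)

lemma trail_H: "trail V E H"
  using circuit_H by (simp add: circuit_def)

lemma H_sub_V: "set H \<subseteq> V"
  using trail_H by (simp add: trail_def walk_def)

lemma length_H: "length H = Suc (off (Suc k))"
  by (subst H_eq) (simp only: length_append off_def list.size)

lemma off_Suc: "1 \<le> j \<Longrightarrow> off (Suc j) = off j + length (Hs j)"
  by (simp add: off_def)

lemma off_le: "1 \<le> i \<Longrightarrow> i < j \<Longrightarrow> off i + length (Hs i) \<le> off j"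
proof (induction j)
  case (Suc j)
  show ?case
  proof (cases "i = j")
    case True
    then show ?thesis using Suc.prems off_Suc by simp
  next
    case False
    then show ?thesis using Suc off_Suc[of j] by simp
  qed
qed simp

lemma H_nth:
  assumes "j \<in> {1..k}" "h < length (Hs j)"
  shows "off j + h < off (Suc k)" "H ! (off j + h) = Hs j ! h"
proof -
  have "off j + length (Hs j) \<le> off (Suc k)" using off_le[of j "Suc k"] assms by simp
  then show "off j + h < off (Suc k)" using assms(2) by simp
  have "[1..<Suc k] = [1..<j] @ j # [Suc j..<Suc k]"
    using assms(1) upt_add_eq_append[of 1 j "Suc k - j"] upt_conv_Cons[of j "Suc k"] by simp
  then have "H = concat (map Hs [1..<j]) @ Hs j @ concat (map Hs [Suc j..<Suc k]) @ [hd (Hs 1)]"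
    by (subst H_eq) (simp del: upt_Suc)
  then show "H ! (off j + h) = Hs j ! h"
    using assms(2) by (simp add: off_def nth_append del: upt_Suc)
qed

lemma set_Hs: "j \<in> {1..k} \<Longrightarrow> set (Hs j) \<subseteq> set H"
  by (subst H_eq) (auto simp del: upt_Suc)

lemma in_segment: "x \<in> set H \<Longrightarrow> \<exists>j\<in>{1..k}. x \<in> set (Hs j)"
proof -
  assume "x \<in> set H"
  then have "x \<in> (\<Union>j\<in>{1..k}. set (Hs j)) \<or> x = hd (Hs 1)"
    by (subst (asm) H_eq) (auto simp del: upt_Suc simp: less_Suc_eq_le)
  moreover have "hd (Hs 1) \<in> set (Hs 1)" "1 \<in> {1..k}" using Hs_ne[of 1] k_pos by auto
  ultimately show ?thesis by blast
qed

lemma e_position: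
  assumes "j \<in> {1..k}"
  shows "off j + length (Hs j) - 1 < length (walk_edges H)"
    and "walk_edges H ! (off j + length (Hs j) - 1) = e j"
proof -
  have len: "length (Hs j) - 1 < length (Hs j)" using Hs_ne[OF assms] by simp
  have idx: "off j + length (Hs j) - 1 = off j + (length (Hs j) - 1)" using len by simp
  show lt: "off j + length (Hs j) - 1 < length (walk_edges H)"
    unfolding idx using H_nth(1)[OF assms len] length_H by simp
  have 1: "H ! (off j + length (Hs j) - 1) = last (Hs j)"
    unfolding idx H_nth(2)[OF assms len] using Hs_ne[OF assms] by (simp add: last_conv_nth)
  \<comment> \<open>The vertex after block \<open>j\<close> opens block \<open>Suc j\<close>, or for
    \<open>j = k\<close> is the base vertex closing the circuit.\<close>
  have 2: "H ! Suc (off j + length (Hs j) - 1) = hd (Hs (if j = k then 1 else Suc j))"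
  proof -
    have idx': "Suc (off j + length (Hs j) - 1) = off (Suc j)"
      using len off_Suc[of j] assms by simp
    show ?thesis
    proof (cases "j = k")
      case True
      have "H ! off (Suc k) = hd (Hs 1)"
        by (subst H_eq) (simp add: off_def nth_append del: upt_Suc)
      then show ?thesis using True idx' by simp
    next
      case False
      then have j: "Suc j \<in> {1..k}" using assms by simp
      then show ?thesis
        using False idx' H_nth(2)[OF j, of 0] Hs_ne[OF j] by (simp add: hd_conv_nth)
    qed
  qed
  have "e j = {last (Hs j), hd (Hs (if j = k then 1 else Suc j))}"
    using segments assms unfolding segmentation_def by blast
  then show "walk_edges H ! (off j + length (Hs j) - 1) = e j"
    using lt 1 2 by (subst nth_walk_edges) auto
qed

lemma e_in_H: "j \<in> {1..k} \<Longrightarrow> e j \<in> edges_of H"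
  using nth_mem[OF e_position(1)[of j]] by (simp only: e_position(2))

text \<open>The edges of \<open>H\<close> are distinct, so an edge determines its index. The index
  of \<open>e i\<close> is that of the step leaving block \<open>i\<close>, while the edges of
  \<open>Hs j\<close> have indices strictly inside block \<open>j\<close>.\<close>

lemma e_notin_segment:
  assumes "i \<in> {1..k}" "j \<in> {1..k}"
  shows "e i \<notin> edges_of (Hs j)"
proof
  assume "e i \<in> edges_of (Hs j)"
  then obtain h where h: "h < length (walk_edges (Hs j))" "walk_edges (Hs j) ! h = e i"
    unfolding in_set_conv_nth by blast
  have h': "Suc h < length (Hs j)" using h(1) by simp
  have lt: "off j + h < length (walk_edges H)" using H_nth(1)[OF assms(2), of h] h' length_H by simp
  have "walk_edges H ! (off j + h) = walk_edges (Hs j) ! h"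
    using h' H_nth[OF assms(2), of h] H_nth[OF assms(2), of "Suc h"] length_H
    by (simp add: nth_walk_edges)
  then have "walk_edges H ! (off j + h) = walk_edges H ! (off i + length (Hs i) - 1)"
    using h(2) e_position[OF assms(1)] by simp
  then have eq: "off j + h = off i + length (Hs i) - 1"
    using trail_H nth_eq_iff_index_eq[OF _ lt e_position(1)[OF assms(1)]] by (simp add: trail_def)
  have "length (Hs i) > 0" using Hs_ne[OF assms(1)] by simp
  then have "off j + h < off i + length (Hs i)" "off j + Suc h \<ge> off i + length (Hs i)"
    using eq by linarith+
  then show False
    using h' off_le[of i j] off_le[of j i] assms by (cases i j rule: linorder_cases) auto
qed

lemma cl_seg_sub_H: "j \<in> {1..k} \<Longrightarrow> set (cl_seg (Hs j) U) \<subseteq> set H"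
  using set_Hs[of j] set_mono_sublist[OF sublist_cl_seg, of "Hs j" U] by blast

lemma cl_sub_H: "cl k Hs U \<subseteq> set H"
  unfolding cl_def using cl_seg_sub_H by blast

lemma L_sub_H: "L v i \<subseteq> set H"
  by (induction V E k Hs H f v i rule: layer.induct) (auto simp: reach_def)

text \<open>Reachability needs a trail, but a walk suffices, as it can be shortened to a path on a
  subset of its vertices.\<close>

lemma reachI:
  assumes "x \<in> X" "y \<in> set H" "walk V (E - edges_of H - {f}) p" "hd p = x" "last p = y"
    "set p \<inter> set H \<subseteq> {x, y}"
  shows "y \<in> reach V E H f X"
proof -
  obtain p' where "walk V (E - edges_of H - {f}) p'" "distinct p'" "hd p' = hd p"
    "last p' = last p" "set p' \<subseteq> set p"
    using walk_to_path[OF assms(3)] .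
  then have "admissible V E H f x y p'"
    using assms distinct_walk_edges[of p'] by (auto simp: admissible_def trail_def)
  then show ?thesis using assms(1,2) by (auto simp: reach_def)
qed

lemma reach_self: "x \<in> X \<Longrightarrow> x \<in> set H \<Longrightarrow> x \<in> reach V E H f X"
  using reachI[of x X x "[x]"] H_sub_V by (auto simp: walk_def)

lemma L_subset_cl: "L v i \<subseteq> cl k Hs (L v i)"
proof
  fix x assume x: "x \<in> L v i"
  then obtain j where j: "j \<in> {1..k}" "x \<in> set (Hs j)"
    using L_sub_H[of v i] in_segment[of x] by blast
  then have "x \<in> set (cl_seg (Hs j) (L v i))" using x subset_cl_seg[of "L v i" "Hs j"] by blast
  then show "x \<in> cl k Hs (L v i)" using j(1) unfolding cl_def by (rule UN_I[rotated])
qed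

text \<open>A layer is contained in its closure, and a trivial trail reaches each vertex of
  \<open>H\<close> from itself.\<close>

lemma L_mono_Suc: "L v i \<subseteq> L v (Suc i)"
proof (cases i)
  case (Suc i')
  have "L v (Suc i') \<subseteq> reach V E H f (cl k Hs (L v (Suc i')))"
  proof
    fix x assume "x \<in> L v (Suc i')"
    then show "x \<in> reach V E H f (cl k Hs (L v (Suc i')))"
      using L_subset_cl[of v "Suc i'"] L_sub_H[of v "Suc i'"] by (intro reach_self) auto
  qed
  then show ?thesis using Suc by simp
qed simp

section \<open>The invariant carried through the descent\<close>

text \<open>What (C2) demands of an ear beyond what being an ear already gives: avoiding
  \<open>H\<close> inside and \<open>edges_of H\<close> is part of \<open>ear\<close>.\<close>

definition ear_ok :: "'a set \<Rightarrow> 'a set \<Rightarrow> 'a \<Rightarrow> 'a list \<Rightarrow> 'a \<Rightarrow> bool" where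
  "ear_ok X Y u ys v \<longleftrightarrow> f \<notin> edges_of (u # ys @ [v]) \<and>
     \<not> (u \<in> X \<and> v \<in> X) \<and> \<not> (u \<in> Y \<and> v \<in> Y)"

definition closures :: "'a set \<Rightarrow> 'a set \<Rightarrow> bool \<Rightarrow> nat \<Rightarrow> 'a list" where
  "closures X Y c j = cl_seg (Hs j) (if c then X else Y)"

text \<open>Coherence in a form that survives cutting and gluing at vertices of \<open>H\<close>:
  (C2) is imposed on ears, (C3) is replaced by \<open>placed\<close>, and closed ears are
  excluded.\<close>

definition good :: "'a \<Rightarrow> 'a \<Rightarrow> nat \<Rightarrow> nat \<Rightarrow> 'a list \<Rightarrow> bool" where
  "good a b n m q \<longleftrightarrow> trail V E q \<and> e ` {1..k} \<subseteq> edges_of q \<and>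
     hd q \<in> L a (Suc n) \<and> last q \<in> L b (Suc m) \<and>
     ears H (\<lambda>u ys v. u \<noteq> v \<and> ear_ok (L a (Suc n)) (L b (Suc m)) u ys v) q \<and>
     placed {1..k} (closures (L a n) (L b m)) q"

lemma ear_ok_rev: "ear_ok X Y u ys v \<Longrightarrow> ear_ok Y X v (rev ys) u"
  using edges_of_rev[of "u # ys @ [v]"] by (auto simp: ear_ok_def)

lemma placed_rev:
  assumes "placed {1..k} (closures X Y) q"
  shows "placed {1..k} (closures Y X) (rev q)"
proof -
  obtain I where I: "\<And>c j. j \<in> {1..k} \<Longrightarrow> subtrail_at (closures X Y c j) q (I c j)"
    "\<And>c c' j j'. j \<in> {1..k} \<Longrightarrow> j' \<in> {1..k} \<Longrightarrow> j \<noteq> j' \<Longrightarrow> sep (I c j) (I c' j')"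
    using assms unfolding placed_def by blast
  let ?l = "length q - 1"
  show ?thesis
  \<comment> \<open>A reversal is a splice whose first part is the whole trail; no position is left
    for the second part.\<close>
  proof (rule placed_splice[where q = q and I = "\<lambda>c. I (\<not> c)" and lo = ?l and hi = "length q"
        and f = "\<lambda>h. ?l - h" and g = "\<lambda>h. h"])
    show "subtrail_at (closures Y X c j) q (I (\<not> c) j)" if "j \<in> {1..k}" for c j
      using I(1)[OF that, of "\<not> c"] by (cases c) (simp_all add: closures_def)
    show "I (\<not> c) j \<subseteq> {..?l} \<or> I (\<not> c) j \<subseteq> {length q..}" if "j \<in> {1..k}" for c j
    proof -
      have "x \<le> ?l" if "x \<in> I (\<not> c) j" for x
        using subtrail_at_less[OF I(1)[OF \<open>j \<in> {1..k}\<close>] that] by linarith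
      then show ?thesis by auto
    qed
    show "subtrail_at p (rev q) ((\<lambda>h. ?l - h) ` J)"
      if "subtrail_at p q J" "J \<subseteq> {..?l}" for p J
    proof (rule subtrail_at_reflect[OF that(1)])
      fix h assume "h \<in> J"
      then have "h < length q" using subtrail_at_less[OF that(1)] by simp
      then show "h \<le> ?l \<and> ?l - h < length (rev q) \<and> rev q ! (?l - h) = q ! h"
        by (auto simp: rev_nth)
    qed
    show "subtrail_at p (rev q) ((\<lambda>h. h) ` J)"
      if J: "subtrail_at p q J" "J \<subseteq> {length q..}" for p J
    proof -
      have "h \<notin> J" for h using subtrail_at_less[OF J(1), of h] J(2) by auto
      then have "J = {}" by auto
      then show ?thesis using J(1) subtrail_at_empty[of p q] by (simp add: subtrail_at_Nil)
    qed
    show "mono_on {..?l} (\<lambda>h. ?l - h) \<or> antimono_on {..?l} (\<lambda>h. ?l - h)"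
      by (auto simp: monotone_on_def)
  qed (use I(2) in \<open>auto simp: monotone_on_def\<close>)
qed

lemma good_rev:
  assumes "good a b n m q"
  shows "good b a m n (rev q)"
proof -
  have "ears H (\<lambda>u ys v. u \<noteq> v \<and> ear_ok (L a (Suc n)) (L b (Suc m)) u ys v) q"
    using assms by (simp add: good_def)
  then have "ears H (\<lambda>u ys v. u \<noteq> v \<and> ear_ok (L b (Suc m)) (L a (Suc n)) u ys v) (rev q)"
    by (rule ears_rev) (auto simp: ear_ok_rev)
  moreover have "trail V E (rev q)" using assms by (simp add: good_def trail_def walk_rev walk_edges_rev)
  moreover have "placed {1..k} (closures (L b m) (L a n)) (rev q)"
    using assms placed_rev unfolding good_def by blast
  moreover have "q \<noteq> []" using assms by (auto simp: good_def trail_def walk_def)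
  ultimately show ?thesis using assms by (simp add: good_def edges_of_rev hd_rev last_rev)
qed

subsection \<open>Cutting the circuit open\<close>

text \<open>The trail runs from position \<open>hi\<close> of \<open>Hs j\<close> once around
  \<open>H\<close> to position \<open>lo\<close>, skipping the edges in between. These belong to
  \<open>Hs j\<close>, so every \<open>e i\<close> survives. All edges are on \<open>H\<close>, so
  there are no ears. By \<open>miss\<close> the closures on \<open>Hs j\<close> are empty, and any
  other block lies entirely on one side of the gap.\<close>

lemma open_circuit:
  assumes j: "j \<in> {1..k}" and lohi: "lo \<le> hi" "hi < length (Hs j)"
    and ends: "Hs j ! hi \<in> L a (Suc c)" "Hs j ! lo \<in> L b (Suc d)"
    and miss: "L a c \<inter> set (Hs j) = {}" "L b d \<inter> set (Hs j) = {}"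
  shows "\<exists>q. good a b c d q"
proof -
  define lo' hi' N where "lo' = off j + lo" and "hi' = off j + hi" and "N = off (Suc k)"
  have le: "lo' \<le> hi'" "hi' < N" "length H = Suc N"
    using lohi H_nth(1)[OF j lohi(2)] length_H by (auto simp: lo'_def hi'_def N_def)
  let ?W = "walk_edges H"
  \<comment> \<open>The base vertex ends the first piece and starts the second; \<open>tl\<close>
    removes the duplicate.\<close>
  define q where "q = drop hi' H @ tl (take (Suc lo') H)"
  have ne: "drop hi' H \<noteq> []" "take (Suc lo') H \<noteq> []" using le by auto
  have join: "last (drop hi' H) = hd (take (Suc lo') H)"
    using le hd_last_H H_ne by (simp add: last_drop)
  have W: "walk_edges q = drop hi' ?W @ take lo' ?W"
    unfolding q_def walk_edges_join[OF ne join] walk_edges_drop walk_edges_take by simp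
  have sub: "edges_of q \<subseteq> edges_of H" unfolding W by (auto dest: in_set_takeD in_set_dropD)
  have "set q \<subseteq> set H"
    unfolding q_def by (cases H) (auto dest: in_set_takeD in_set_dropD)
  then have "walk V E q"
    using trail_H sub ne unfolding trail_def walk_def q_def by auto
  moreover have "distinct (walk_edges q)"
    using trail_H set_take_disj_set_drop_if_distinct[OF _ le(1), of ?W]
    unfolding W by (auto simp: trail_def)
  ultimately have trail: "trail V E q" by (simp add: trail_def)
  have es: "e ` {1..k} \<subseteq> edges_of q"
  proof
    fix g assume "g \<in> e ` {1..k}"
    then obtain i where i: "i \<in> {1..k}" "g = e i" by blast
    have "e i \<in> set (take lo' ?W) \<union> set (drop hi' ?W)"
    proof (rule in_take_or_drop[OF e_in_H[OF i(1)]])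
      fix h assume h: "lo' \<le> h" "h < hi'"
      define h0 where "h0 = h - off j"
      have h0: "h = off j + h0" "Suc h0 < length (Hs j)" using h lohi by (auto simp: h0_def lo'_def hi'_def)
      have "?W ! h = walk_edges (Hs j) ! h0"
        using h0 H_nth[OF j, of h0] H_nth[OF j, of "Suc h0"] length_H by (simp add: nth_walk_edges)
      also have "\<dots> \<in> edges_of (Hs j)" using h0(2) by (intro nth_mem) simp
      finally show "?W ! h \<noteq> e i" using e_notin_segment[OF i(1) j] by metis
    qed
    then show "g \<in> edges_of q" using i(2) W by auto
  qed
  have hd_q: "hd q = Hs j ! hi"
    using ne(1) le H_nth(2)[OF j lohi(2)] by (simp add: q_def hd_append hd_drop_conv_nth hi'_def)
  have nth2: "q ! (h + N - hi') = H ! h" if "h \<le> lo'" for h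
  proof -
    have "length (drop hi' H) - 1 + h = h + N - hi'" using le by simp
    then show ?thesis using nth_join[OF ne(1) join, of h] that le unfolding q_def by simp
  qed
  have length_q: "length q = N - hi' + lo' + 1" using le by (simp add: q_def)
  have q_ne: "q \<noteq> []" using ne by (simp add: q_def)
  have "last q = q ! (lo' + N - hi')" using q_ne length_q le by (simp add: last_conv_nth add.commute)
  then have last_q: "last q = Hs j ! lo"
    using nth2[of lo'] H_nth(2)[OF j, of lo] lohi by (simp add: lo'_def)
  have "\<exists>I. I \<subseteq> {off i..<off i + length (Hs i)} \<and> subtrail_at (closures (L a c) (L b d) z i) H I"
    if i: "i \<in> {1..k}" for z i
  proof -
    obtain r where r: "length (Hs i) = Suc r" using Hs_ne[OF i] by (cases "Hs i") auto
    have "\<forall>h\<le>r. Hs i ! h = H ! (off i + h)" "off i + r < length H"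
      using r H_nth(2)[OF i] H_nth(1)[OF i, of r] length_H by auto
    then have "subtrail_at (Hs i) H {off i..off i + r}"
      unfolding subtrail_at_def using r by (intro disjI2 exI[of _ "off i"] exI[of _ r]) simp
    moreover have "sublist (closures (L a c) (L b d) z i) (Hs i)"
      by (simp add: closures_def sublist_cl_seg)
    ultimately obtain I where "I \<subseteq> {off i..off i + r}" "subtrail_at (closures (L a c) (L b d) z i) H I"
      using subtrail_at_sublist[of "Hs i" H "{off i..off i + r}"] by blast
    moreover have "{off i..off i + r} = {off i..<off i + length (Hs i)}" using r by auto
    ultimately show ?thesis by auto
  qed
  then have "\<forall>z. \<forall>i\<in>{1..k}. \<exists>I. I \<subseteq> {off i..<off i + length (Hs i)} \<and>
      subtrail_at (closures (L a c) (L b d) z i) H I"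
    by simp
  then have "\<exists>I. \<forall>z. \<forall>i\<in>{1..k}. I z i \<subseteq> {off i..<off i + length (Hs i)} \<and>
      subtrail_at (closures (L a c) (L b d) z i) H (I z i)"
    by (simp only: bchoice_iff choice_iff)
  then obtain I where "\<forall>z. \<forall>i\<in>{1..k}. I z i \<subseteq> {off i..<off i + length (Hs i)} \<and>
      subtrail_at (closures (L a c) (L b d) z i) H (I z i)" ..
  then have I: "\<And>z i. i \<in> {1..k} \<Longrightarrow> I z i \<subseteq> {off i..<off i + length (Hs i)}"
    "\<And>z i. i \<in> {1..k} \<Longrightarrow> subtrail_at (closures (L a c) (L b d) z i) H (I z i)"
    by auto
  have "placed {1..k} (closures (L a c) (L b d)) q"
  \<comment> \<open>The part of \<open>H\<close> up to \<open>lo'\<close> is moved behind the part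
    from \<open>hi'\<close> on, so the images under \<open>f\<close> follow those under
    \<open>g\<close>.\<close>
  proof (rule placed_splice[where q = H and I = I and lo = lo' and hi = hi'
        and f = "\<lambda>h. h + N - hi'" and g = "\<lambda>h. h + 0 - hi'"])
    show "subtrail_at (closures (L a c) (L b d) z i) H (I z i)" if "i \<in> {1..k}" for z i
      using I(2)[OF that] .
    show "sep (I z i) (I z' i')" if i: "i \<in> {1..k}" "i' \<in> {1..k}" "i \<noteq> i'" for z z' i i'
    proof -
      have "sep {off i..<off i + length (Hs i)} {off i'..<off i' + length (Hs i')}"
        using i off_le[of i i'] off_le[of i' i] by (cases i i' rule: linorder_cases) (auto simp: sep_def)
      then show ?thesis by (rule sep_subset) (use I(1) i in auto)
    qed
    show "I z i \<subseteq> {..lo'} \<or> I z i \<subseteq> {hi'..}" if i: "i \<in> {1..k}" for z i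
    proof (cases i j rule: linorder_cases)
      case less
      then have "{off i..<off i + length (Hs i)} \<subseteq> {..lo'}"
        using off_le[of i j] i by (auto simp: lo'_def)
      then show ?thesis using I(1)[OF i, of z] by blast
    next
      case equal
      then have "closures (L a c) (L b d) z i = []"
        using miss by (simp add: closures_def cl_seg_eq_Nil)
      then show ?thesis using I(2)[OF i, of z] by (simp add: subtrail_at_Nil)
    next
      case greater
      then have "{off i..<off i + length (Hs i)} \<subseteq> {hi'..}"
        using off_le[of j i] j lohi by (auto simp: hi'_def)
      then show ?thesis using I(1)[OF i, of z] by blast
    qed
    show "subtrail_at p q ((\<lambda>h. h + N - hi') ` J)" if "subtrail_at p H J" "J \<subseteq> {..lo'}" for p J
    proof (rule subtrail_at_shift[OF that(1)])
      fix h assume "h \<in> J"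
      then have "h \<le> lo'" using that(2) by auto
      then show "hi' \<le> h + N \<and> h + N - hi' < length q \<and> q ! (h + N - hi') = H ! h"
        using nth2 le length_q by auto
    qed
    show "subtrail_at p q ((\<lambda>h. h + 0 - hi') ` J)" if "subtrail_at p H J" "J \<subseteq> {hi'..}" for p J
    proof (rule subtrail_at_shift[OF that(1)])
      fix h assume "h \<in> J"
      then have h: "hi' \<le> h" "h < length H" using that(2) subtrail_at_less[OF that(1)] by auto
      then have "h - hi' < length H - hi'" by linarith
      then have "q ! (h - hi') = H ! h" using h unfolding q_def by (simp add: nth_append)
      then show "hi' \<le> h + 0 \<and> h + 0 - hi' < length q \<and> q ! (h + 0 - hi') = H ! h"
        using h le length_q by auto
    qed
    show "mono_on {..lo'} (\<lambda>h. h + N - hi') \<or> antimono_on {..lo'} (\<lambda>h. h + N - hi')"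
      by (intro disjI1) (auto simp: monotone_on_def)
    show "mono_on {hi'..} (\<lambda>h. h + 0 - hi')" by (auto simp: monotone_on_def)
    show "sep ((\<lambda>h. h + N - hi') ` {..lo'}) ((\<lambda>h. h + 0 - hi') ` {hi'..<length H})"
      using le by (auto simp: sep_def)
  qed
  then have "good a b c d q"
    unfolding good_def using trail es ends hd_q last_q ears_subset[OF sub] by simp
  then show ?thesis ..
qed

text \<open>Layer 0 is empty, so for each of \<open>a\<close> and \<open>b\<close> some layer is the
  first to meet the segment. The circuit is opened between vertices of these two layers; if they
  occur in the wrong order, the roles of \<open>a\<close> and \<open>b\<close> are exchanged and the
  result is reversed.\<close>

lemma good_of_common_segment:
  assumes j: "j \<in> {1..k}" and "L a n \<inter> set (Hs j) \<noteq> {}" "L b m \<inter> set (Hs j) \<noteq> {}"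
  shows "\<exists>c<n. \<exists>d<m. \<exists>q. good a b c d q"
proof -
  have least: "\<exists>c<i. L v c \<inter> set (Hs j) = {} \<and> L v (Suc c) \<inter> set (Hs j) \<noteq> {}"
    if "L v i \<inter> set (Hs j) \<noteq> {}" for v i
    using that
  proof (induction i)
    case (Suc i)
    then show ?case by (cases "L v i \<inter> set (Hs j) = {}") (auto intro: less_SucI)
  qed simp
  obtain c d where cd: "c < n" "L a c \<inter> set (Hs j) = {}" "L a (Suc c) \<inter> set (Hs j) \<noteq> {}"
    "d < m" "L b d \<inter> set (Hs j) = {}" "L b (Suc d) \<inter> set (Hs j) \<noteq> {}"
    using least[OF assms(2)] least[OF assms(3)] by (elim exE conjE) rule
  obtain x y where x: "x < length (Hs j)" "Hs j ! x \<in> L a (Suc c)"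
    and y: "y < length (Hs j)" "Hs j ! y \<in> L b (Suc d)"
    using cd(3,6) unfolding disjoint_iff in_set_conv_nth by auto
  have "\<exists>q. good a b c d q"
  proof (cases "y \<le> x")
    case True
    then show ?thesis using open_circuit[OF j True] x y cd by blast
  next
    case False
    then have "\<exists>q. good b a d c q" using open_circuit[OF j, of x y] x y cd by simp
    then show ?thesis using good_rev by blast
  qed
  then show ?thesis using cd by blast
qed

subsection \<open>Rotation\<close>

lemma edge_two_vertices: "g \<in> E \<Longrightarrow> \<exists>u v. g = {u, v} \<and> u \<noteq> v"
  using simple unfolding simple_graph_def by blast

text \<open>If the shared edge has both ends on \<open>H\<close>, it joins the ends of
  \<open>p\<close> and also the ends of the ear. Otherwise \<open>p\<close> and the ear share a
  vertex off \<open>H\<close>, at which one can switch from \<open>p\<close> to the ear and follow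
  it to either end.\<close>

lemma ear_ends_reached:
  assumes ear: "ear H u ys v" "walk V E (u # ys @ [v])" "f \<notin> edges_of (u # ys @ [v])"
    and p: "walk V (E - edges_of H - {f}) p" "distinct p" "set p \<inter> set H \<subseteq> {hd p, last p}"
    and X: "hd p \<in> X" "hd p \<in> set H" "last p \<in> set H"
    and g: "g \<in> edges_of p" "g \<in> edges_of (u # ys @ [v])"
  shows "u \<in> reach V E H f X \<and> v \<in> reach V E H f X"
proof -
  let ?E' = "E - edges_of H - {f}"
  let ?c = "u # ys @ [v]"
  have uv: "u \<in> set H" "v \<in> set H" "set ys \<inter> set H = {}" using ear(1) by (auto simp: ear_def)
  have c: "walk V ?E' ?c" using ear(2,3) ear_edges_off[OF ear(1)] by (auto simp: walk_def)
  have gp: "g \<subseteq> set p" and gc: "g \<subseteq> set ?c" using g edge_of_walk_subset by blast+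
  show ?thesis
  proof (cases "g \<subseteq> set H")
    case True
    have "g \<in> E" using g(2) ear(2) unfolding walk_def by blast
    then obtain y z where yz: "g = {y, z}" "y \<noteq> z" using edge_two_vertices by blast
    have "g \<subseteq> {hd p, last p}" using gp True p(3) by auto
    then have gp': "g = {hd p, last p}" using yz by auto
    have "g \<subseteq> {u, v}" using gc True uv(3) by auto
    then have guv: "g = {u, v}" using yz by auto
    have "hd p \<in> reach V E H f X" using reach_self X by blast
    moreover have "last p \<in> reach V E H f X" using reachI[OF X(1) X(3) p(1) refl refl p(3)] .
    ultimately have "g \<subseteq> reach V E H f X" using gp' by simp
    then show ?thesis using guv by simp
  next
    case False
    then obtain z where z: "z \<in> set p" "z \<in> set ys" "z \<notin> set H" using gp gc uv by auto
    obtain p1 p2 where p12: "p = p1 @ z # p2" using split_list[OF z(1)] by blast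
    have "p2 \<noteq> []" using z(3) X(3) p12 by auto
    then have last: "last p \<in> set p2" using p12 by simp
    have "hd (p1 @ [z]) = hd p" using p12 by (simp add: hd_append)
    have "sublist (p1 @ [z]) p"
      unfolding p12 sublist_def by (intro exI[of _ "[]"] exI[of _ p2]) simp
    then have wp: "walk V ?E' (p1 @ [z])" using walk_sublist[OF p(1)] by simp
    \<comment> \<open>\<open>p\<close> is a path and its last vertex comes after \<open>z\<close>,
      so the part up to \<open>z\<close> meets \<open>H\<close> at most in its start.\<close>
    have "last p \<notin> set (p1 @ [z])" using p(2) last p12 by auto
    then have sp: "set (p1 @ [z]) \<inter> set H \<subseteq> {hd p}" using p(3) p12 by auto
    \<comment> \<open>Stated for a generic \<open>y\<close>, to serve both ends of the ear;
      \<open>zs\<close> is the stretch of the ear between \<open>z\<close> and that end.\<close>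
    have *: "y \<in> reach V E H f X"
      if w: "walk V ?E' (z # zs @ [y])" "set zs \<inter> set H = {}" "y \<in> set H" for zs y
    proof (rule reachI[OF X(1) w(3), where p = "(p1 @ [z]) @ tl (z # zs @ [y])"])
      let ?r = "(p1 @ [z]) @ tl (z # zs @ [y])"
      show "walk V ?E' ?r" by (rule walk_join[OF wp w(1)]) simp
      show "hd ?r = hd p" using p12 by (simp add: hd_append)
      show "last ?r = y" by simp
      have "set ?r = set (p1 @ [z]) \<union> set zs \<union> {y}" by auto
      then show "set ?r \<inter> set H \<subseteq> {hd p, y}" using sp w(2) by blast
    qed
    obtain y1 y2 where y12: "ys = y1 @ z # y2" using split_list[OF z(2)] by blast
    have "sublist (z # y2 @ [v]) ?c"
      unfolding y12 sublist_def by (intro exI[of _ "u # y1"] exI[of _ "[]"]) simp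
    then have "v \<in> reach V E H f X"
      using *[of y2 v] walk_sublist[OF c, of "z # y2 @ [v]"] uv y12 by auto
    moreover have "sublist (u # y1 @ [z]) ?c"
      unfolding y12 sublist_def by (intro exI[of _ "[]"] exI[of _ "y2 @ [v]"]) simp
    then have "u \<in> reach V E H f X"
      using *[of "rev y1" u] walk_rev[OF walk_sublist[OF c, of "u # y1 @ [z]"]] uv y12 by auto
    ultimately show ?thesis by simp
  qed
qed

text \<open>The ends of an ear in \<open>p\<close> are distinct vertices of \<open>H\<close>, so
  they are exactly the two ends of \<open>p\<close>.\<close>

lemma path_ears:
  assumes p: "distinct p" "set p \<inter> set H \<subseteq> {hd p, last p}" "f \<notin> edges_of p"
    and "\<not> (hd p \<in> X \<and> last p \<in> X)" "\<not> (hd p \<in> Y \<and> last p \<in> Y)"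
  shows "ears H (\<lambda>u ys v. u \<noteq> v \<and> ear_ok X Y u ys v) p"
  unfolding ears_def
proof (intro allI impI)
  fix u ys v assume s: "sublist (u # ys @ [v]) p" and e: "ear H u ys v"
  have "u \<noteq> v" using s p(1) by (auto simp: sublist_def)
  moreover have "{u, v} \<subseteq> {hd p, last p}"
    using e p(2) set_mono_sublist[OF s] by (auto simp: ear_def)
  ultimately have uv: "{u, v} = {hd p, last p}" by auto
  have "f \<notin> edges_of (u # ys @ [v])"
    using p(3) set_mono_sublist[OF sublist_walk_edges[OF s]] by blast
  then show "u \<noteq> v \<and> ear_ok X Y u ys v"
    using uv \<open>u \<noteq> v\<close> assms(4,5) unfolding ear_ok_def doubleton_eq_iff by auto
qed

text \<open>\<open>apart\<close> is used twice: it keeps the attachment vertex \<open>x\<close> out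
  of the opposite layer, and it empties the opposite closure on the segment where \<open>q\<close>
  is cut.\<close>

lemma rotate:
  assumes good: "good a b (Suc n) m q"
    and new: "hd q \<notin> L a (Suc n)"
    and apart: "\<And>j. j \<in> {1..k} \<Longrightarrow>
      L a (Suc n) \<inter> set (Hs j) = {} \<or> L b (Suc m) \<inter> set (Hs j) = {}"
  shows "\<exists>q. good a b n m q"
proof -
  let ?X = "L a (Suc n)" and ?Y = "L b (Suc m)" and ?E' = "E - edges_of H - {f}"
  have tr: "trail V E q" and es: "e ` {1..k} \<subseteq> edges_of q"
    and hd_q: "hd q \<in> L a (Suc (Suc n))" and last_q: "last q \<in> ?Y"
    and q_ears: "ears H (\<lambda>u ys v. u \<noteq> v \<and> ear_ok (L a (Suc (Suc n))) ?Y u ys v) q"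
    and pl: "placed {1..k} (closures ?X (L b m)) q"
    using good by (simp_all add: good_def del: layer.simps)
  have q_ne: "q \<noteq> []" and wq: "walk V E q" using tr by (auto simp: trail_def walk_def)
  have LX: "L a (Suc (Suc n)) = reach V E H f (cl k Hs ?X)" by simp
  obtain x p0 where x: "x \<in> cl k Hs ?X" and p0: "admissible V E H f x (hd q) p0"
    using hd_q unfolding LX reach_def by blast
  have "walk V ?E' p0" using p0 by (simp add: admissible_def trail_def)
  then obtain p where "walk V ?E' p" "distinct p" "hd p = hd p0" "last p = last p0" "set p \<subseteq> set p0"
    by (rule walk_to_path)
  then have p: "walk V ?E' p" "distinct p" "hd p = x" "last p = hd q" "set p \<inter> set H \<subseteq> {x, hd q}"
    using p0 by (auto simp: admissible_def)
  have p_ne: "p \<noteq> []" using p(1) by (simp add: walk_def)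
  have hd_q_H: "hd q \<in> set H" using hd_q L_sub_H[of a "Suc (Suc n)"] by blast
  have last_q_H: "last q \<in> set H" using last_q L_sub_H[of b "Suc m"] by blast
  have x_H: "x \<in> set H" using x cl_sub_H[of ?X] by blast
  obtain j where j: "j \<in> {1..k}" and xj: "x \<in> set (cl_seg (Hs j) ?X)"
    using x unfolding cl_def by blast
  have xY: "x \<notin> ?Y"
  proof -
    have ne: "cl_seg (Hs j) ?X \<noteq> []" using xj by auto
    have "hd (cl_seg (Hs j) ?X) \<in> ?X \<inter> set (Hs j)"
      using cl_seg_ends(1)[OF ne] set_mono_sublist[OF sublist_cl_seg, of "Hs j" ?X] hd_in_set[OF ne]
      by blast
    then have "?Y \<inter> set (Hs j) = {}" using apart[OF j] by blast
    moreover have "x \<in> set (Hs j)" using xj set_mono_sublist[OF sublist_cl_seg, of "Hs j" ?X] by blast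
    ultimately show ?thesis by blast
  qed
  \<comment> \<open>Otherwise \<open>hd q\<close> would be reached one layer earlier, against
    \<open>new\<close>.\<close>
  have x_new: "x \<notin> cl k Hs (L a n)"
  proof (cases n)
    case 0
    then show ?thesis by (simp add: cl_def cl_seg_eq_Nil)
  next
    case (Suc n')
    show ?thesis
    proof
      assume "x \<in> cl k Hs (L a n)"
      then have "hd q \<in> reach V E H f (cl k Hs (L a n))"
        using hd_q_H p0 unfolding reach_def by blast
      then show False using new Suc by simp
    qed
  qed
  obtain I where I: "\<And>c i. i \<in> {1..k} \<Longrightarrow> subtrail_at (closures ?X (L b m) c i) q (I c i)"
    "\<And>c c' i i'. i \<in> {1..k} \<Longrightarrow> i' \<in> {1..k} \<Longrightarrow> i \<noteq> i' \<Longrightarrow> sep (I c i) (I c' i')"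
    using pl unfolding placed_def by blast
  have IA: "subtrail_at (cl_seg (Hs i) ?X) q (I True i)" if "i \<in> {1..k}" for i
    using I(1)[OF that, of True] by (simp add: closures_def)
  have IB: "subtrail_at (cl_seg (Hs i) (L b m)) q (I False i)" if "i \<in> {1..k}" for i
    using I(1)[OF that, of False] by (simp add: closures_def)
  have "x \<in> (!) q ` I True j"
    unfolding subtrail_at_vertices[OF IA[OF j]] by (rule xj)
  then obtain s where s: "s \<in> I True j" "q ! s = x" by auto
  have s_len: "s < length q" using subtrail_at_less[OF IA[OF j] s(1)] .
  have "I True j \<noteq> {}" using s(1) by auto
  then obtain t r where tr': "I True j = {t..t + r}" "q ! t \<in> ?X" "q ! (t + r) \<in> ?X"
    by (rule subtrail_at_cl_seg_ends[OF IA[OF j]])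
  \<comment> \<open>The new first vertex has to lie in the layer \<open>?X\<close>; taking the last
    such position up to \<open>s\<close> ensures that no end of a smaller closure lies strictly
    between \<open>i\<close> and \<open>s\<close>.\<close>
  define i where "i = Max {h \<in> {t..s}. q ! h \<in> ?X}"
  have fin: "finite {h \<in> {t..s}. q ! h \<in> ?X}" by simp
  have "t \<in> {h \<in> {t..s}. q ! h \<in> ?X}" using tr' s(1) by simp
  then have "i \<in> {h \<in> {t..s}. q ! h \<in> ?X}" unfolding i_def by (intro Max_in[OF fin]) auto
  then have i: "t \<le> i" "i \<le> s" "q ! i \<in> ?X" by auto
  have i_max: "h \<le> i" if "t \<le> h" "h \<le> s" "q ! h \<in> ?X" for h
    unfolding i_def using that by (intro Max_ge) auto
  have is_I: "h \<in> I True j" if "i \<le> h" "h \<le> s" for h using that i tr' s(1) by auto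

  \<comment> \<open>A shared edge is off \<open>H\<close>, hence lies on an ear of \<open>q\<close>.
    Both ends of that ear would be in the layer \<open>Suc (Suc n)\<close>, which
    \<open>ear_ok\<close> forbids.\<close>
  have disj: "edges_of p \<inter> edges_of q = {}"
  proof (rule ccontr)
    assume "edges_of p \<inter> edges_of q \<noteq> {}"
    then obtain g where g: "g \<in> edges_of p" "g \<in> edges_of q" by blast
    then have g_off: "g \<notin> edges_of H" using p(1) unfolding walk_def by blast
    obtain h where "h < length (walk_edges q)" "g = walk_edges q ! h"
      using g(2) unfolding in_set_conv_nth by blast
    then have h: "0 < Suc h" "Suc h < length q" "g = {q ! (Suc h - 1), q ! Suc h}"
      by (simp_all add: nth_walk_edges)
    obtain xs u ys v zs where ear: "q = xs @ (u # ys @ [v]) @ zs" "ear H u ys v"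
        "length xs < Suc h" "Suc h \<le> length xs + length ys + 1"
        "g \<in> edges_of (u # ys @ [v])"
      by (rule ear_around[OF hd_q_H last_q_H h(1,2), unfolded h(3)[symmetric], OF g_off])
    have sub: "sublist (u # ys @ [v]) q" using ear(1) by (auto simp: sublist_def)
    then have ok: "ear_ok (L a (Suc (Suc n))) ?Y u ys v" using q_ears ear(2) unfolding ears_def by blast
    have "u \<in> reach V E H f (cl k Hs ?X) \<and> v \<in> reach V E H f (cl k Hs ?X)"
    proof (rule ear_ends_reached[OF ear(2) walk_sublist[OF wq sub] _ p(1,2) _ _ _ _ g(1) ear(5)])
      show "f \<notin> edges_of (u # ys @ [v])" using ok by (simp only: ear_ok_def) blast
    qed (use p x x_H hd_q_H in auto)
    then show False using ok unfolding ear_ok_def LX by blast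
  qed

  \<comment> \<open>The new trail goes back from \<open>q ! i\<close> to \<open>hd q\<close>, along
    \<open>p\<close> reversed to \<open>x = q ! s\<close>, and on to the end of
    \<open>q\<close>.\<close>
  define y1 where "y1 = rev (take (Suc i) q)"
  define y2 where "y2 = y1 @ tl (rev p)"
  define y where "y = y2 @ tl (drop s q)"
  have y1: "y1 \<noteq> []" "length y1 = Suc i" "last y1 = hd q" "hd y1 = q ! i"
    using q_ne i s_len by (auto simp: y1_def last_rev hd_rev last_conv_nth)
  have j1: "last y1 = hd (rev p)" using y1 p p_ne by (simp add: hd_rev)
  have y2: "y2 \<noteq> []" "length y2 = i + length p" "hd y2 = q ! i"
    using y1 p_ne by (auto simp: y2_def)
  have "last y2 = last (rev p)"
    unfolding y2_def using y1(1) p_ne j1 by (intro last_join) auto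
  then have j2: "last y2 = hd (drop s q)"
    using p p_ne s s_len by (simp add: last_rev hd_drop_conv_nth)
  have d_ne: "drop s q \<noteq> []" using s_len by simp
  let ?W = "walk_edges q"
  have W: "walk_edges y = rev (take i ?W) @ rev (walk_edges p) @ drop s ?W"
    unfolding y_def walk_edges_join[OF y2(1) d_ne j2] unfolding y2_def
    using walk_edges_join[OF y1(1) _ j1] p_ne
    by (simp add: y1_def walk_edges_rev walk_edges_take walk_edges_drop)
  have y_ne: "y \<noteq> []" and hd_y: "hd y = q ! i" using y2 by (auto simp: y_def)
  have last_y: "last y = last q"
    unfolding y_def using last_join[OF y2(1) d_ne j2] s_len by simp
  have "set y \<subseteq> set p \<union> set q"
    using set_tl_subset[of "rev p"] set_tl_subset[of "drop s q"] set_take_subset[of "Suc i" q]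
      set_drop_subset[of s q]
    unfolding y_def y2_def y1_def by auto
  then have set_y: "set y \<subseteq> V" using p(1) wq unfolding walk_def by blast
  have edges_y: "edges_of y \<subseteq> edges_of p \<union> edges_of q"
    unfolding W by (auto dest: in_set_takeD in_set_dropD)
  then have "walk V E y" using set_y y_ne p(1) wq unfolding walk_def by blast
  moreover have "distinct (walk_edges y)"
    using tr disj distinct_walk_edges[OF p(2)] set_take_disj_set_drop_if_distinct[OF _ i(2), of ?W]
    unfolding W trail_def by (auto dest: in_set_takeD in_set_dropD)
  ultimately have trail_y: "trail V E y" by (simp add: trail_def)
  have es_y: "e ` {1..k} \<subseteq> edges_of y"
  proof
    fix g assume "g \<in> e ` {1..k}"
    then obtain c where c: "c \<in> {1..k}" "g = e c" by blast
    \<comment> \<open>The edges lost between \<open>i\<close> and \<open>s\<close> belong to a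
      closure inside \<open>Hs j\<close>.\<close>
    have "e c \<in> set (take i ?W) \<union> set (drop s ?W)"
    proof (rule in_take_or_drop)
      show "e c \<in> set ?W" using es c by blast
      fix h assume h: "i \<le> h" "h < s" "h < length ?W"
      then have "{q ! h, q ! Suc h} \<in> edges_of (cl_seg (Hs j) ?X)"
        by (intro subtrail_at_edge[OF IA[OF j]] is_I) auto
      then have "?W ! h \<in> edges_of (Hs j)"
        using h set_mono_sublist[OF sublist_walk_edges[OF sublist_cl_seg[of "Hs j" ?X]]]
        by (simp add: nth_walk_edges subset_iff)
      then show "?W ! h \<noteq> e c" using e_notin_segment[OF c(1) j] by metis
    qed
    then show "g \<in> edges_of y" using c W by auto
  qed
  have ears_y: "ears H (\<lambda>u ys v. u \<noteq> v \<and> ear_ok ?X ?Y u ys v) y"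
  proof -
    let ?ok = "\<lambda>u ys v. u \<noteq> v \<and> ear_ok ?X ?Y u ys v"
    have E: "ears H ?ok q"
      using q_ears by (rule ears_weaken) (use L_mono_Suc[of a "Suc n"] in \<open>auto simp: ear_ok_def\<close>)
    \<comment> \<open>The condition is symmetric in the two layers; they are swapped here because
      reversing the piece swaps them back.\<close>
    have "ears H (\<lambda>u ys v. u \<noteq> v \<and> ear_ok ?Y ?X u ys v) q"
      using E by (rule ears_weaken) (auto simp: ear_ok_def)
    then have "ears H (\<lambda>u ys v. u \<noteq> v \<and> ear_ok ?Y ?X u ys v) (take (Suc i) q)"
      using sublist_take by (rule ears_sublist)
    then have 1: "ears H ?ok y1"
      unfolding y1_def by (rule ears_rev) (auto simp: ear_ok_rev)
    have "ears H (\<lambda>u ys v. u \<noteq> v \<and> ear_ok ?Y ?X u ys v) p"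
      using p new xY p(1) by (intro path_ears) (auto simp: walk_def)
    then have 2: "ears H ?ok (rev p)"
      by (rule ears_rev) (auto simp: ear_ok_rev)
    have 3: "ears H ?ok y2"
      unfolding y2_def using 1 2 y1(1) p_ne j1 hd_q_H y1(3) by (intro ears_join) auto
    have 4: "ears H ?ok (drop s q)" using E sublist_drop by (rule ears_sublist)
    show ?thesis
      unfolding y_def using 3 4 y2(1) d_ne j2 x_H s s_len
      by (intro ears_join) (auto simp: hd_drop_conv_nth)
  qed
  have "\<exists>I'\<subseteq>I True c. subtrail_at (cl_seg (Hs c) (L a n)) q I'" if "c \<in> {1..k}" for c
    by (rule subtrail_at_sublist[OF IA[OF that] cl_seg_mono[OF L_mono_Suc]])
  then have "\<forall>c\<in>{1..k}. \<exists>I'. I' \<subseteq> I True c \<and> subtrail_at (cl_seg (Hs c) (L a n)) q I'"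
    by auto
  then obtain IA' where "\<forall>c\<in>{1..k}. IA' c \<subseteq> I True c \<and>
      subtrail_at (cl_seg (Hs c) (L a n)) q (IA' c)"
    unfolding bchoice_iff ..
  then have IA': "\<And>c. c \<in> {1..k} \<Longrightarrow> IA' c \<subseteq> I True c"
    "\<And>c. c \<in> {1..k} \<Longrightarrow> subtrail_at (cl_seg (Hs c) (L a n)) q (IA' c)"
    by auto
  define I' where "I' z c = (if z then IA' c else I False c)" for z c
  have I'_sub: "I' z c \<subseteq> I z c" if "c \<in> {1..k}" for z c
    using IA'(1)[OF that] by (cases z) (auto simp: I'_def)
  \<comment> \<open>Both \<open>i\<close> and \<open>s\<close> belong to the interval of segment
    \<open>j\<close>, so anything separated from it lies on one side of the gap.\<close>
  have side_sep: "A \<subseteq> {..i} \<or> A \<subseteq> {s..}" if "sep (I True j) A" for A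
    using that is_I[of i] is_I[of s] i(2) unfolding sep_def by fastforce
  have side: "I' z c \<subseteq> {..i} \<or> I' z c \<subseteq> {s..}" if c: "c \<in> {1..k}" for z c
  proof (cases "c = j")
    case False
    then have "sep (I True j) (I' z c)" using sep_subset[OF I(2)[OF j c] _ I'_sub[OF c]] by blast
    then show ?thesis by (rule side_sep)
  next
    case cj: True
    show ?thesis
    proof (cases z)
      case True
      have I'z: "I' z c = IA' j" using True cj by (simp add: I'_def)
      show ?thesis
      proof (cases "IA' j = {}")
        case False
        obtain t' r' where t': "IA' j = {t'..t' + r'}" "q ! t' \<in> L a n" "q ! (t' + r') \<in> L a n"
          by (rule subtrail_at_cl_seg_ends[OF IA'(2)[OF j] False])
        \<comment> \<open>By \<open>x_new\<close>, the interval of the smaller closure misses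
          \<open>s\<close>. If it ends before \<open>s\<close>, its last vertex is in
          \<open>?X\<close>, and maximality of \<open>i\<close> puts it at or before
          \<open>i\<close>.\<close>
        have "s \<notin> IA' j"
        proof
          assume "s \<in> IA' j"
          then have "x \<in> set (cl_seg (Hs j) (L a n))"
            using subtrail_at_vertices[OF IA'(2)[OF j]] s(2) by blast
          then show False using x_new j unfolding cl_def by blast
        qed
        then consider "t' + r' < s" | "s < t'" using t'(1) by fastforce
        then show ?thesis
        proof cases
          case 1
          have "t' + r' \<in> I True j" using IA'(1)[OF j] t'(1) by auto
          then have "t' + r' \<le> i"
            using 1 t'(3) L_mono_Suc[of a n] tr'(1) by (intro i_max) auto
          then show ?thesis using I'z t'(1) by auto
        next
          case 2
          then show ?thesis using I'z t'(1) by auto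
        qed
      qed (simp add: I'z)
    next
      case False
      have "cl_seg (Hs j) ?X \<noteq> []" using xj by auto
      then have "?X \<inter> set (Hs j) \<noteq> {}" using cl_seg_eq_Nil by blast
      then have "L b m \<inter> set (Hs j) = {}" using apart[OF j] L_mono_Suc[of b m] by blast
      then have "I False j = {}" using IB[OF j] by (simp add: cl_seg_eq_Nil subtrail_at_Nil)
      then show ?thesis using False cj by (simp add: I'_def)
    qed
  qed
  \<comment> \<open>The position of \<open>q ! s\<close> in the new trail. A trivial
    \<open>p\<close> gives \<open>l = i\<close>, and intervals from the two sides may then share
    this position.\<close>
  define l where "l = i + length p - 1"
  have l: "i \<le> l" "length y2 - 1 = l" using p_ne y2(2) by (cases p; simp add: l_def)+
  have length_y: "length y = l + (length q - s)"
    using y2(2) l s_len p_ne by (cases p) (auto simp: y_def l_def)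
  have "placed {1..k} (closures (L a n) (L b m)) y"
  proof (rule placed_splice[where q = q and I = I' and lo = i and hi = s
        and f = "\<lambda>h. i - h" and g = "\<lambda>h. h + l - s"])
    show "subtrail_at (closures (L a n) (L b m) z c) q (I' z c)" if "c \<in> {1..k}" for z c
      using IA'(2)[OF that] IB[OF that] by (cases z) (simp_all add: I'_def closures_def)
    show "sep (I' z c) (I' z' c')" if "c \<in> {1..k}" "c' \<in> {1..k}" "c \<noteq> c'" for z z' c c'
      using sep_subset[OF I(2)[OF that] I'_sub[OF that(1)] I'_sub[OF that(2)]] .
    show "I' z c \<subseteq> {..i} \<or> I' z c \<subseteq> {s..}" if "c \<in> {1..k}" for z c
      using side[OF that] .
    show "subtrail_at P y ((\<lambda>h. i - h) ` J)" if "subtrail_at P q J" "J \<subseteq> {..i}" for P J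
    proof (rule subtrail_at_reflect[OF that(1)])
      fix h assume "h \<in> J"
      then have h: "h \<le> i" using that(2) by auto
      have "i - h < length y1" using y1(2) by linarith
      then have "y ! (i - h) = y1 ! (i - h)" by (simp add: y_def y2_def nth_append)
      also have "\<dots> = q ! h" using h i s_len by (simp add: y1_def rev_nth)
      finally show "h \<le> i \<and> i - h < length y \<and> y ! (i - h) = q ! h"
        using h l length_y s_len by simp
    qed
    show "subtrail_at P y ((\<lambda>h. h + l - s) ` J)" if "subtrail_at P q J" "J \<subseteq> {s..}" for P J
    proof (rule subtrail_at_shift[OF that(1)])
      fix h assume "h \<in> J"
      then have h: "s \<le> h" "h < length q" using that(2) subtrail_at_less[OF that(1)] by auto
      have "l + (h - s) = h + l - s" using h by simp
      then have "y ! (h + l - s) = q ! h"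
        using nth_join[OF y2(1) j2, of "h - s"] h l unfolding y_def by simp
      then show "s \<le> h + l \<and> h + l - s < length y \<and> y ! (h + l - s) = q ! h"
        using h length_y by simp
    qed
    show "mono_on {..i} (\<lambda>h. i - h) \<or> antimono_on {..i} (\<lambda>h. i - h)"
      by (intro disjI2) (auto simp: monotone_on_def)
    show "mono_on {s..} (\<lambda>h. h + l - s)" by (auto simp: monotone_on_def)
    show "sep ((\<lambda>h. i - h) ` {..i}) ((\<lambda>h. h + l - s) ` {s..<length q})"
      using l by (auto simp: sep_def)
  qed
  then have "good a b n m y"
    unfolding good_def using trail_y es_y hd_y i(3) last_y last_q ears_y by (simp del: layer.simps)
  then show ?thesis ..
qed

subsection \<open>Closed ears and the descent\<close>

text \<open>A closed ear is contracted to its base vertex \<open>u\<close>, by induction on the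
  length. It has no edge on \<open>H\<close>, so no \<open>e i\<close> is lost; and since witnessing
  intervals are convex and visit only \<open>H\<close>, none of them enters it.\<close>

lemma remove_closed_ears:
  assumes "trail V E q" "e ` {1..k} \<subseteq> edges_of q" "hd q \<in> A" "last q \<in> B"
    and "ears H (\<lambda>u ys v. u \<noteq> v \<longrightarrow> ear_ok X Y u ys v) q"
    and "placed {1..k} (closures U W) q"
  shows "\<exists>q. trail V E q \<and> e ` {1..k} \<subseteq> edges_of q \<and> hd q \<in> A \<and> last q \<in> B \<and>
    ears H (\<lambda>u ys v. u \<noteq> v \<and> ear_ok X Y u ys v) q \<and> placed {1..k} (closures U W) q"
  using assms
proof (induction "length q" arbitrary: q rule: less_induct)
  case less
  note tr = less.prems(1) and es = less.prems(2) and q_ears = less.prems(5)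
  show ?case
  proof (cases "\<exists>u ys. sublist (u # ys @ [u]) q \<and> ear H u ys u")
    case False
    then have "ears H (\<lambda>u ys v. u \<noteq> v \<and> ear_ok X Y u ys v) q"
      using q_ears unfolding ears_def by blast
    then show ?thesis using less.prems by blast
  next
    case True
    then obtain u ys xs zs where ear: "ear H u ys u" and q: "q = xs @ (u # ys @ [u]) @ zs"
      unfolding sublist_def by blast
    let ?c = "u # ys @ [u]"
    \<comment> \<open>The positions of the two copies of \<open>u\<close> that bound the
      ear.\<close>
    define lo hi where "lo = length xs" and "hi = length xs + length ys + 1"
    define y where "y = (xs @ [u]) @ tl (u # zs)"
    have uH: "u \<in> set H" and ysH: "set ys \<inter> set H = {}" using ear by (auto simp: ear_def)
    have "q = (xs @ [u]) @ tl (?c @ tl (u # zs))" using q by simp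
    then have Wq: "walk_edges q = walk_edges (xs @ [u]) @ walk_edges ?c @ walk_edges (u # zs)"
      using walk_edges_join[of "xs @ [u]" "?c @ tl (u # zs)"] walk_edges_join[of ?c "u # zs"] by simp
    have Wy: "walk_edges y = walk_edges (xs @ [u]) @ walk_edges (u # zs)"
      unfolding y_def by (rule walk_edges_join) auto
    have wq: "walk V E q" using tr by (simp add: trail_def)
    have ys_ne: "ys \<noteq> []"
    proof
      assume "ys = []"
      then have "{u} \<in> E" using wq Wq by (auto simp: walk_def)
      then show False using edge_two_vertices[of "{u}"] by auto
    qed
    have nth1: "y ! h = q ! h" if "h \<le> lo" for h
      using that by (cases "h = lo") (auto simp: y_def q lo_def nth_append)
    have nth2: "y ! (h + lo - hi) = q ! h" if "hi \<le> h" "h < length q" for h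
    proof -
      have "y ! (lo + (h - hi)) = (u # zs) ! (h - hi)"
        unfolding y_def lo_def by (simp add: nth_append)
      moreover have "q ! (hi + (h - hi)) = (u # zs) ! (h - hi)"
        unfolding q hi_def by (simp add: nth_append)
      ultimately show ?thesis using that by (simp add: add.commute)
    qed
    have length_y: "length y + hi = length q + lo" by (simp add: y_def q lo_def hi_def)
    have "trail V E y"
      using tr Wq Wy unfolding trail_def walk_def y_def q by auto
    moreover have "e ` {1..k} \<subseteq> edges_of y"
    proof
      fix g assume "g \<in> e ` {1..k}"
      then have "g \<in> edges_of H" "g \<in> edges_of q" using e_in_H es by auto
      then show "g \<in> edges_of y" using ear_edges_off[OF ear] unfolding Wq Wy by auto
    qed
    moreover have "hd y = hd q" "last y = last q" by (auto simp: y_def q hd_append)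
    then have "hd y \<in> A" "last y \<in> B" using less.prems by auto
    moreover have "ears H (\<lambda>u ys v. u \<noteq> v \<longrightarrow> ear_ok X Y u ys v) y"
    proof -
      have "sublist (xs @ [u]) q"
        unfolding q sublist_def by (intro exI[of _ "[]"] exI[of _ "ys @ [u] @ zs"]) simp
      moreover have "sublist (u # zs) q"
        unfolding q sublist_def by (intro exI[of _ "xs @ u # ys"] exI[of _ "[]"]) simp
      ultimately show ?thesis
        unfolding y_def using ears_sublist[OF q_ears] uH by (intro ears_join) auto
    qed
    moreover have "placed {1..k} (closures U W) y"
    proof -
      obtain I where I: "\<And>c j. j \<in> {1..k} \<Longrightarrow> subtrail_at (closures U W c j) q (I c j)"
        "\<And>c c' j j'. j \<in> {1..k} \<Longrightarrow> j' \<in> {1..k} \<Longrightarrow> j \<noteq> j' \<Longrightarrow> sep (I c j) (I c' j')"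
        using less.prems(6) unfolding placed_def by blast
      show ?thesis
      proof (rule placed_splice[where q = q and I = I and lo = lo and hi = hi
            and f = "\<lambda>h. h + 0 - 0" and g = "\<lambda>h. h + lo - hi"])
        show "I c j \<subseteq> {..lo} \<or> I c j \<subseteq> {hi..}" if j: "j \<in> {1..k}" for c j
        proof (rule ccontr)
          assume "\<not> (I c j \<subseteq> {..lo} \<or> I c j \<subseteq> {hi..})"
          then obtain h h' where h: "h \<in> I c j" "lo < h" "h' \<in> I c j" "h' < hi"
            by (auto simp: subset_iff not_le)
          have H: "q ! g \<in> set H" if "g \<in> I c j" for g
            using subtrail_at_vertices[OF I(1)[OF j, of c]] that cl_seg_sub_H[OF j]
            unfolding closures_def by blast
          have "q ! g \<in> set ys" if g: "lo < g" "g < hi" for g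
          proof -
            obtain g' where g': "g = Suc (length xs + g')"
              using less_imp_Suc_add[OF g(1)] by (auto simp: lo_def)
            moreover from this have "g' < length ys" using g by (simp add: hi_def)
            ultimately have "q ! g = ys ! g'" by (simp add: q nth_append)
            then show ?thesis using \<open>g' < length ys\<close> by simp
          qed
          then have out: "g \<le> lo \<or> hi \<le> g" if "g \<in> I c j" for g
            using H[OF that] ysH by (metis IntI emptyE not_le)
          have "h' \<le> lo" "hi \<le> h" using out[OF h(1)] out[OF h(3)] h by auto
          \<comment> \<open>By convexity, an interval with points on both sides would contain the
            position of the first inner vertex, which exists by \<open>ys_ne\<close>.\<close>
          then have "Suc lo \<in> I c j"
            using subtrail_at_convex[OF I(1)[OF j] h(3,1)] h(2) by simp
          then show False using out ys_ne by (force simp: lo_def hi_def)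
        qed
        show "subtrail_at P y ((\<lambda>h. h + 0 - 0) ` J)" if "subtrail_at P q J" "J \<subseteq> {..lo}" for P J
        proof (rule subtrail_at_shift[OF that(1)])
          fix h assume "h \<in> J"
          then have "h \<le> lo" using that(2) by auto
          then show "0 \<le> h + 0 \<and> h + 0 - 0 < length y \<and> y ! (h + 0 - 0) = q ! h"
            using nth1[of h] by (simp add: y_def lo_def)
        qed
        show "subtrail_at P y ((\<lambda>h. h + lo - hi) ` J)" if "subtrail_at P q J" "J \<subseteq> {hi..}" for P J
        proof (rule subtrail_at_shift[OF that(1)])
          fix h assume "h \<in> J"
          then have "hi \<le> h" "h < length q" using that(2) subtrail_at_less[OF that(1)] by auto
          then show "hi \<le> h + lo \<and> h + lo - hi < length y \<and> y ! (h + lo - hi) = q ! h"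
            using nth2[of h] length_y by auto
        qed
        show "sep ((\<lambda>h. h + 0 - 0) ` {..lo}) ((\<lambda>h. h + lo - hi) ` {hi..<length q})"
          by (auto simp: sep_def)
        show "mono_on {..lo} (\<lambda>h. h + 0 - 0) \<or> antimono_on {..lo} (\<lambda>h. h + 0 - 0)"
          by (intro disjI1) (auto simp: monotone_on_def)
        show "mono_on {hi..} (\<lambda>h. h + lo - hi)" by (auto simp: monotone_on_def)
      qed (use I in auto)
    qed
    moreover have "length y < length q" by (simp add: y_def q)
    ultimately show ?thesis using less.hyps[of y] by blast
  qed
qed

section \<open>Passing between coherence and the invariant\<close>

text \<open>An excursion from (C2) around an edge of an ear contains the whole ear. It meets
  \<open>H\<close> only in its ends, so the ends of an ear with \<open>u \<noteq> v\<close> are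
  those of the excursion and inherit its conditions. Closed ears escape this argument and are
  deleted afterwards.\<close>

lemma good_of_coherent:
  assumes f: "f = e (Suc k)" and coh: "coherent V E k e a b Hs H n m q"
  shows "\<exists>q. good a b n m q"
proof -
  let ?X = "L a (Suc n)" and ?Y = "L b (Suc m)"
  have tr: "trail V E q" and es: "\<forall>i\<in>{1..k}. e i \<in> edges_of q"
    and ends: "q ! 0 \<in> ?X" "q ! (length q - 1) \<in> ?Y"
    and c2: "\<And>s. s \<in> {1..length q - 1} \<Longrightarrow> {q ! (s - 1), q ! s} \<in> E - edges_of H \<Longrightarrow>
      \<exists>r t. r < s \<and> s \<le> t \<and> t \<le> length q - 1 \<and> q ! r \<in> set H \<and> q ! t \<in> set H \<and>
        admissible V E H f (q ! r) (q ! t) (take (Suc (t - r)) (drop r q)) \<and>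
        \<not> (q ! r \<in> ?X \<and> q ! t \<in> ?X) \<and> \<not> (q ! r \<in> ?Y \<and> q ! t \<in> ?Y)"
    and c3: "\<exists>IA IB :: nat \<Rightarrow> nat set.
            (\<forall>j\<in>{1..k}. subtrail_at (cl_seg (Hs j) (L a n)) q (IA j) \<and>
                        subtrail_at (cl_seg (Hs j) (L b m)) q (IB j)) \<and>
            (\<forall>j\<in>{1..k}. \<forall>j'\<in>{1..k}. j \<noteq> j' \<longrightarrow>
               (\<forall>I\<in>{IA, IB}. \<forall>J\<in>{IA, IB}. I j \<inter> J j' = {}))"
    using coh unfolding coherent_def Let_def f[symmetric] Suc_eq_plus1[symmetric] by blast+
  have q_ne: "q \<noteq> []" using tr by (auto simp: trail_def walk_def)
  have q_ears: "ears H (\<lambda>u ys v. u \<noteq> v \<longrightarrow> ear_ok ?X ?Y u ys v) q"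
    unfolding ears_def
  proof (intro allI impI)
    fix u ys v assume "sublist (u # ys @ [v]) q" and ear: "ear H u ys v" and "u \<noteq> v"
    then obtain xs zs where q: "q = xs @ (u # ys @ [v]) @ zs" by (auto simp: sublist_def)
    let ?c = "u # ys @ [v]"
    \<comment> \<open>(C2) is applied to the first edge of the ear.\<close>
    define s where "s = length xs + 1"
    have sub: "sublist ?c q" using q by (auto simp: sublist_def)
    have nth: "q ! (length xs + h) = ?c ! h" if "h < length ?c" for h
      using that nth_append[of ?c zs h] unfolding q nth_append_length_plus by simp
    have s: "s \<in> {1..length q - 1}" by (auto simp: s_def q)
    have "{q ! (s - 1), q ! s} = walk_edges ?c ! 0"
      using nth[of 0] nth[of 1] by (subst nth_walk_edges) (auto simp: s_def)
    also have "\<dots> \<in> edges_of ?c" by (intro nth_mem) simp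
    finally have g: "{q ! (s - 1), q ! s} \<in> edges_of ?c" .
    moreover have "edges_of ?c \<subseteq> E"
      using walk_sublist[of V E q ?c] sub tr by (simp add: trail_def walk_def)
    ultimately have "{q ! (s - 1), q ! s} \<in> E - edges_of H" using ear_edges_off[OF ear] by blast
    from c2[OF s this] obtain r t where rt: "r < s" "s \<le> t" "t \<le> length q - 1" "q ! t \<in> set H"
        "admissible V E H f (q ! r) (q ! t) (take (Suc (t - r)) (drop r q))"
        "\<not> (q ! r \<in> ?X \<and> q ! t \<in> ?X)" "\<not> (q ! r \<in> ?Y \<and> q ! t \<in> ?Y)"
      by blast
    \<comment> \<open>The excursion ends on \<open>H\<close>, so it cannot stop at an inner vertex
      of the ear.\<close>
    have t: "length xs + length ys + 1 \<le> t"
    proof (rule ccontr)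
      assume "\<not> ?thesis"
      then obtain h where h: "t = length xs + Suc h" "h < length ys"
        using rt(2) by (intro that[of "t - length xs - 1"]) (auto simp: s_def)
      then have "q ! t = ys ! h" using nth[of "Suc h"] by (simp add: nth_append)
      then have "q ! t \<in> set ys \<inter> set H" using h(2) rt(4) by simp
      then show False using ear unfolding ear_def by blast
    qed
    let ?d = "take (Suc (t - r)) (drop r q)"
    have r: "r \<le> length xs" using rt(1) by (simp add: s_def)
    obtain c where c: "t = length xs + length ys + 1 + c" using le_Suc_ex[OF t] by blast
    have "?d = drop r xs @ ?c @ take c zs"
    proof -
      have "Suc (t - r) = length (drop r xs) + length ?c + c" using r unfolding c by simp
      moreover have "drop r q = drop r xs @ ?c @ zs" using r by (simp add: q)
      ultimately show ?thesis by (simp only:) simp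
    qed
    then have sub': "sublist ?c ?d" by (auto simp: sublist_def)
    have adm: "edges_of ?d \<subseteq> E - edges_of H - {f}" "set ?d \<inter> set H \<subseteq> {q ! r, q ! t}"
      using rt(5) unfolding admissible_def trail_def walk_def by blast+
    have "f \<notin> edges_of ?c"
      using adm(1) set_mono_sublist[OF sublist_walk_edges[OF sub']] by blast
    moreover have "{u, v} \<subseteq> {q ! r, q ! t}"
      using adm(2) set_mono_sublist[OF sub'] ear unfolding ear_def by auto
    then have "{u, v} = {q ! r, q ! t}" using \<open>u \<noteq> v\<close> by auto
    ultimately show "ear_ok ?X ?Y u ys v"
      using rt(6,7) unfolding ear_ok_def doubleton_eq_iff by auto
  qed
  have q_placed: "placed {1..k} (closures (L a n) (L b m)) q"
  proof -
    obtain IA IB :: "nat \<Rightarrow> nat set" where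
      sub: "\<forall>j\<in>{1..k}. subtrail_at (cl_seg (Hs j) (L a n)) q (IA j) \<and>
        subtrail_at (cl_seg (Hs j) (L b m)) q (IB j)" and
      dis: "\<forall>j\<in>{1..k}. \<forall>j'\<in>{1..k}. j \<noteq> j' \<longrightarrow>
        (\<forall>I\<in>{IA, IB}. \<forall>J\<in>{IA, IB}. I j \<inter> J j' = {})"
      using c3 by (elim exE conjE) rule
    define I where "I c = (if c then IA else IB)" for c
    have 1: "subtrail_at (closures (L a n) (L b m) c j) q (I c j)" if "j \<in> {1..k}" for c j
      using bspec[OF sub that] by (simp add: I_def closures_def)
    have 2: "sep (I c j) (I c' j')" if j: "j \<in> {1..k}" "j' \<in> {1..k}" "j \<noteq> j'" for c c' j j'
    proof -
      have "\<forall>I\<in>{IA, IB}. \<forall>J\<in>{IA, IB}. I j \<inter> J j' = {}" using dis j by blast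
      then have "I c j \<inter> I c' j' = {}" by (simp add: I_def)
      moreover have "z \<in> I c j" if "x \<in> I c j" "y \<in> I c j" "x \<le> z" "z \<le> y" for x y z
        using subtrail_at_convex[OF 1[OF j(1)] that] .
      moreover have "z \<in> I c' j'" if "x \<in> I c' j'" "y \<in> I c' j'" "x \<le> z" "z \<le> y" for x y z
        using subtrail_at_convex[OF 1[OF j(2)] that] .
      ultimately show ?thesis by (rule disjoint_convex_sep)
    qed
    show ?thesis unfolding placed_def using 1 2 by (intro exI[of _ I]) simp
  qed
  have es': "e ` {1..k} \<subseteq> edges_of q" using es by blast
  have ends': "hd q \<in> ?X" "last q \<in> ?Y"
    using ends q_ne by (simp_all add: hd_conv_nth last_conv_nth del: layer.simps)
  show ?thesis
    unfolding good_def by (rule remove_closed_ears[OF tr es' ends' q_ears q_placed])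
qed

text \<open>The excursion demanded by (C2) is the ear around the given edge. As layer 0 is empty,
  all closures are empty and (C3) is met by empty intervals.\<close>

lemma coherent_of_good:
  assumes f: "f = e (Suc k)" and good: "good a b 0 0 q"
  shows "coherent V E k e a b Hs H 0 0 q"
proof -
  let ?X = "L a (Suc 0)" and ?Y = "L b (Suc 0)"
  have tr: "trail V E q" and es: "e ` {1..k} \<subseteq> edges_of q"
    and ends: "hd q \<in> ?X" "last q \<in> ?Y"
    and q_ears: "ears H (\<lambda>u ys v. u \<noteq> v \<and> ear_ok ?X ?Y u ys v) q"
    using good by (simp_all add: good_def del: layer.simps)
  have q_ne: "q \<noteq> []" using tr by (auto simp: trail_def walk_def)
  have endsH: "hd q \<in> set H" "last q \<in> set H"
    using ends L_sub_H[of a "Suc 0"] L_sub_H[of b "Suc 0"] by (blast)+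
  have c2: "\<exists>r t. r < s \<and> s \<le> t \<and> t \<le> length q - 1 \<and> q ! r \<in> set H \<and> q ! t \<in> set H \<and>
        admissible V E H f (q ! r) (q ! t) (take (Suc (t - r)) (drop r q)) \<and>
        \<not> (q ! r \<in> ?X \<and> q ! t \<in> ?X) \<and> \<not> (q ! r \<in> ?Y \<and> q ! t \<in> ?Y)"
    if s: "s \<in> {1..length q - 1}" "{q ! (s - 1), q ! s} \<in> E - edges_of H" for s
  proof -
    have "0 < s" "s < length q" "{q ! (s - 1), q ! s} \<notin> edges_of H"
      using s q_ne by (cases q; auto)+
    then obtain xs u ys v zs where q: "q = xs @ (u # ys @ [v]) @ zs" and ear: "ear H u ys v"
      and len: "length xs < s" "s \<le> length xs + length ys + 1"
      and "{q ! (s - 1), q ! s} \<in> edges_of (u # ys @ [v])"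
      by (rule ear_around[OF endsH])
    let ?c = "u # ys @ [v]" and ?r = "length xs" and ?t = "length xs + length ys + 1"
    have sub: "sublist ?c q" using q by (auto simp: sublist_def)
    have ok: "ear_ok ?X ?Y u ys v" using q_ears sub ear unfolding ears_def by blast
    have slice: "take (Suc (?t - ?r)) (drop ?r q) = ?c" by (simp add: q)
    have rt: "q ! ?r = u" "q ! ?t = v" by (simp_all add: q nth_append)
    have uv: "u \<in> set H" "v \<in> set H" "set ys \<inter> set H = {}" using ear by (auto simp: ear_def)
    have "walk V E ?c" using walk_sublist[of V E q ?c] tr sub by (simp add: trail_def)
    moreover have "f \<notin> edges_of ?c" using ok unfolding ear_ok_def by blast
    moreover have "distinct (walk_edges ?c)"
      using sublist_walk_edges[OF sub] tr unfolding trail_def sublist_def by (metis distinct_append)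
    ultimately have "trail V (E - edges_of H - {f}) ?c"
      using ear_edges_off[OF ear] unfolding trail_def walk_def by blast
    then have "admissible V E H f u v ?c" using uv by (auto simp: admissible_def)
    moreover have "?t \<le> length q - 1" by (simp add: q)
    ultimately show ?thesis
      using len uv ok rt slice unfolding ear_ok_def
      by (intro exI[of _ ?r] exI[of _ ?t]) (simp del: layer.simps)
  qed
  have c3: "\<exists>IA IB :: nat \<Rightarrow> nat set.
            (\<forall>j\<in>{1..k}. subtrail_at (cl_seg (Hs j) (L a 0)) q (IA j) \<and>
                        subtrail_at (cl_seg (Hs j) (L b 0)) q (IB j)) \<and>
            (\<forall>j\<in>{1..k}. \<forall>j'\<in>{1..k}. j \<noteq> j' \<longrightarrow>
               (\<forall>I\<in>{IA, IB}. \<forall>J\<in>{IA, IB}. I j \<inter> J j' = {}))"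
    by (intro exI[of _ "\<lambda>_. {}"]) (simp add: cl_seg_eq_Nil subtrail_at_Nil)
  have "\<forall>i\<in>{1..k}. e i \<in> edges_of q" using es by blast
  moreover have "q ! 0 \<in> ?X" "q ! (length q - 1) \<in> ?Y"
    using ends q_ne by (simp_all add: hd_conv_nth last_conv_nth del: layer.simps)
  ultimately show ?thesis
    unfolding coherent_def Let_def f[symmetric] add_0 One_nat_def
    using tr c2 c3 by (simp only: One_nat_def) blast
qed

section \<open>The descent\<close>

lemma good_descend:
  assumes "good a b n m q"
  shows "\<exists>q. good a b 0 0 q"
  using assms
proof (induction "n + m" arbitrary: a b n m q rule: less_induct)
  case less
  \<comment> \<open>Stated for arbitrary \<open>a'\<close> and \<open>b'\<close>, so that it also
    applies to the reversed trail when only the second index is positive. If \<open>hd q'\<close> is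
    already in the smaller layer, \<open>q'\<close> itself serves for \<open>n'\<close>.\<close>
  have step: "\<exists>c d q. c + d < Suc n' + m' \<and> good a' b' c d q"
    if g: "good a' b' (Suc n') m' q'" for a' b' n' m' q'
  proof (cases "hd q' \<in> L a' (Suc n')")
    case True
    have "ears H (\<lambda>u ys v. u \<noteq> v \<and> ear_ok (L a' (Suc n')) (L b' (Suc m')) u ys v) q'"
      using g L_mono_Suc[of a' "Suc n'"] unfolding good_def
      by (auto elim!: ears_weaken simp: ear_ok_def)
    moreover have "placed {1..k} (closures (L a' n') (L b' m')) q'"
    proof (rule placed_sublist)
      show "placed {1..k} (closures (L a' (Suc n')) (L b' m')) q'"
        using g by (simp add: good_def del: layer.simps)
      show "sublist (closures (L a' n') (L b' m') c j) (closures (L a' (Suc n')) (L b' m') c j)" for c j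
        using cl_seg_mono[OF L_mono_Suc[of a' n']] by (simp add: closures_def del: layer.simps)
    qed
    ultimately have "good a' b' n' m' q'" using g True unfolding good_def by blast
    then show ?thesis by (intro exI[of _ n'] exI[of _ m'] exI[of _ q']) simp
  next
    case False
    show ?thesis
    proof (cases "\<exists>j\<in>{1..k}. L a' (Suc n') \<inter> set (Hs j) \<noteq> {} \<and> L b' (Suc m') \<inter> set (Hs j) \<noteq> {}")
      case True
      then obtain c d q where "c < Suc n'" "d < Suc m'" "good a' b' c d q"
        using good_of_common_segment[of _ a' "Suc n'" b' "Suc m'"] by blast
      then show ?thesis by (intro exI[of _ c] exI[of _ d] exI[of _ q]) simp
    next
      case F: False
      obtain q where "good a' b' n' m' q" using rotate[OF g False] F by blast
      then show ?thesis by (intro exI[of _ n'] exI[of _ m'] exI[of _ q]) simp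
    qed
  qed
  show ?case
  proof (cases n)
    case (Suc n')
    then obtain c d q' where "c + d < n + m" "good a b c d q'" using step less.prems by blast
    then show ?thesis using less.hyps by blast
  next
    case n: 0
    show ?thesis
    proof (cases m)
      case 0
      then show ?thesis using n less.prems by blast
    next
      case (Suc m')
      then have "good b a (Suc m') n (rev q)" using good_rev less.prems by blast
      then obtain c d q' where cd: "c + d < n + m" "good b a c d q'"
        using step[of b a m' n "rev q"] unfolding Suc by (metis add.commute)
      then have "good a b d c (rev q')" using good_rev by blast
      then show ?thesis using less.hyps[of d c] cd(1) by (simp add: add.commute)
    qed
  qed
qed

end

theorem theorem4p9:
  fixes V :: "'a set" and E :: "'a set set"
    and k :: nat and e :: "nat \<Rightarrow> 'a set" and a b :: 'a
    and H :: "'a list" and Hs :: "nat \<Rightarrow> 'a list"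
    and n m :: nat
  assumes "simple_graph V E"
    and "edge_connected 2 V E"
    and "k \<ge> 1"
    and "\<forall>i\<in>{1..k + 1}. e i \<in> E"
    and "e (k + 1) = {a, b}"
    and "shortest_circuit_through V E (e ` {1..k}) H"
    and "segmentation k e Hs H"
    and "\<exists>Q. coherent V E k e a b Hs H n m Q"
  shows "\<exists>Q. coherent V E k e a b Hs H 0 0 Q"
proof -
  interpret segmented_circuit V E k e Hs H "e (Suc k)"
    using assms by unfold_locales (simp_all add: shortest_circuit_through_def)
  obtain Q where "coherent V E k e a b Hs H n m Q" using assms(8) by blast
  then obtain q where "good a b n m q" using good_of_coherent[OF refl] by blast
  then obtain q where "good a b 0 0 q" using good_descend by blast
  then show ?thesis using coherent_of_good[OF refl] by blast
qed

end
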